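(* Let $A$ be a finite alphabet of colors and $I$ a sentence over $A$ of size $n$. Then $$F_I=\sum_K L^{-1}_{I,K}\,\mathfrak{S}^*_K,\qquad L^{-1}_{I,K}=\sum_{\mathcal{P}}(-1)^{\ell(\mathcal{P})}\,prod(\mathcal{P}),$$ where the first sum runs over all sentences $K$ reachable from $I$ in the colored immaculate descent graph $\mathfrak{D}^n_A$ (including $K=I$ via the empty path) and the second over all directed paths $\mathcal{P}$ from $I$ to $K$ in $\mathfrak{D}^n_A$.
   Context: Words over $A$ are finite sequences of colors; a sentence is a finite sequence $I=(w_1,\dots,w_k)$ of nonempty words; $|I|$ = number of letters, $w(I)=w_1\cdots w_k$; $J\preceq I$ means $w(J)=w(I)$ and $I$ arises from $J$ by concatenating adjacent words. Let $x_{a,i}$ ($a\in A$, $i\ge1$) be variables subject only to $x_{a,i}x_{b,j}=x_{b,j}x_{a,i}$ for $i\ne j$; $x_{w,i}=x_{c_1,i}\cdots x_{c_r,i}$ for $w=c_1\cdots c_r$, $x_{\emptyset,i}=1$; $M_I=\sum_{j_1<\dots<j_k}x_{w_1,j_1}\cdots x_{w_k,j_k}$, $F_I=\sum_{J\preceq I}M_J$. For $J=(w_1,\dots,w_k)$ the colored composition diagram has $k$ left-justified rows (row 1 on top), row $i$ with $|w_i|$ boxes colored in order by the letters of $w_i$. A colored immaculate tableau (CIT) of shape $J$ fills the boxes with positive integers weakly increasing left to right in rows and strictly increasing top to bottom in the first column; its type is $(u_1,\dots,u_m)$, $u_i$ the colors of boxes containing $i$ read from lowest row to highest and left to right within rows;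 $x_T=x_{u_1,1}\cdots x_{u_m,m}$; $\mathfrak{S}^*_J=\sum_T x_T$ over CIT of shape $J$. A standard CIT (SCIT) of size $n$ has entries $1,\dots,n$ each once; descent at $i$ if $i+1$ is in a strictly lower row than $i$; $co_A(U)$ is the sentence obtained by reading colors in order of entries and starting a new word after each descent. $L_{I,J}$ = number of SCIT of shape $I$ with $co_A=J$. The colored immaculate descent graph $\mathfrak{D}^n_A$ is the edge-weighted directed simple graph whose vertices are the sentences over $A$ of size $n$, with an edge $I\to J$ (for $J\neq I$) whenever some SCIT of shape $I$ has colored descent composition $J$, weighted by $L_{I,J}$. For a directed path $\mathcal{P}$, $\ell(\mathcal{P})$ is its number of edges and $prod(\mathcal{P})$ the product of its edge weights, with the empty path having $\ell=0$ and $prod=1$. $K$ is reachable from $I$ if there is a directed path from $I$ to $K$. *)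

theory Defs
  imports Main "Graph_Theory.Arc_Walk"
begin

section \<open>Partially commutative variables and formal series\<close>

text \<open>The pair \<open>(a, i)\<close> is the variable \<open>x_{a,i}\<close>. Words in the variables are identified
  precisely along the commutations \<open>x_{a,i} x_{b,j} = x_{b,j} x_{a,i}\<close> for \<open>i \<noteq> j\<close>.
  Only variables with \<open>i \<ge> 1\<close> occur in the series below.\<close>

inductive var_swap :: "('a \<times> nat) list \<Rightarrow> ('a \<times> nat) list \<Rightarrow> bool" where
  "i \<noteq> j \<Longrightarrow> var_swap (u @ [(a, i), (b, j)] @ v) (u @ [(b, j), (a, i)] @ v)"

quotient_type 'a monom = "('a \<times> nat) list" / "equivclp var_swap"
  by (rule equivp_evquivclp)

lemma equivclp_var_swap_context:
  assumes "equivclp var_swap u v"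
  shows "equivclp var_swap (p @ u @ q) (p @ v @ q)"
proof -
  have step: "var_swap (p @ y @ q) (p @ z @ q)" if "var_swap y z" for y z :: "('a \<times> nat) list"
    using that
  proof cases
    case (1 i j u' a b v')
    then show ?thesis
      using var_swap.intros[of i j "p @ u'" a b "v' @ q"] by simp
  qed
  have "(symclp var_swap)\<^sup>*\<^sup>* u v"
    using assms by (simp add: equivclp_def)
  then have "(symclp var_swap)\<^sup>*\<^sup>* (p @ u @ q) (p @ v @ q)"
  proof (induction rule: rtranclp_induct)
    case base
    show ?case by simp
  next
    case (step y z)
    have "symclp var_swap (p @ y @ q) (p @ z @ q)"
      using step.hyps(2) \<open>\<And>z y. var_swap y z \<Longrightarrow> var_swap (p @ y @ q) (p @ z @ q)\<close>
      by (auto simp: symclp_def)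
    with step.IH show ?case by (rule rtranclp.rtrancl_into_rtrancl)
  qed
  then show ?thesis by (simp add: equivclp_def)
qed

instantiation monom :: (type) monoid_mult
begin

lift_definition one_monom :: "'a monom" is "[]" .

lift_definition times_monom :: "'a monom \<Rightarrow> 'a monom \<Rightarrow> 'a monom" is "(@)"
proof -
  fix u u' v v' :: "('a \<times> nat) list"
  assume "equivclp var_swap u u'" "equivclp var_swap v v'"
  then have "equivclp var_swap (u @ v) (u' @ v)" "equivclp var_swap (u' @ v) (u' @ v')"
    using equivclp_var_swap_context[of u u' "[]" v] equivclp_var_swap_context[of v v' u' "[]"]
    by simp_all
  then show "equivclp var_swap (u @ v) (u' @ v')"
    by (rule equivclp_trans)
qed

instance
  by standard (transfer; simp add: equivp_reflp[OF equivp_evquivclp])+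

end

lift_definition xvar :: "'a \<Rightarrow> nat \<Rightarrow> 'a monom" is "\<lambda>a i. [(a, i)]" .

definition xword :: "'a list \<Rightarrow> nat \<Rightarrow> 'a monom" where
  "xword w i = prod_list (map (\<lambda>c. xvar c i) w)"

text \<open>A formal series is its family of (integer) coefficients; \<open>monom_series S f\<close> is the formal
  sum of the monomials \<open>f s\<close> over the index set \<open>S\<close>. In every use below each monomial arises
  from only finitely many indices, so that \<open>card\<close> is the true multiplicity.\<close>

type_synonym 'a series = "'a monom \<Rightarrow> int"

definition monom_series :: "'s set \<Rightarrow> ('s \<Rightarrow> 'a monom) \<Rightarrow> 'a series" where
  "monom_series S f = (\<lambda>m. int (card {s \<in> S. f s = m}))"

section \<open>Sentences and the functions M and F\<close>

definition sentence :: "'a list list \<Rightarrow> bool" where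
  "sentence I \<longleftrightarrow> [] \<notin> set I"

definition sentence_size :: "'a list list \<Rightarrow> nat" where
  "sentence_size I = length (concat I)"

definition sentences :: "'a set \<Rightarrow> nat \<Rightarrow> 'a list list set" where
  "sentences A n = {I. sentence I \<and> set (concat I) \<subseteq> A \<and> sentence_size I = n}"

text \<open>\<open>J \<preceq> I\<close>: the list \<open>B\<close> groups the words of \<open>J\<close> into consecutive blocks, each of
  which is concatenated to one word of \<open>I\<close>.\<close>

definition refines :: "'a list list \<Rightarrow> 'a list list \<Rightarrow> bool" where
  "refines J I \<longleftrightarrow> concat J = concat I \<and> (\<exists>B. [] \<notin> set B \<and> J = concat B \<and> I = map concat B)"

definition M_fun :: "'a list list \<Rightarrow> 'a series" where
  "M_fun I = monom_series
     {js. length js = length I \<and> sorted_wrt (<) js \<and> (\<forall>j \<in> set js. 1 \<le> j)}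
     (\<lambda>js. prod_list (map2 xword I js))"

definition F_fun :: "'a list list \<Rightarrow> 'a series" where
  "F_fun I = (\<lambda>m. \<Sum>J \<in> {J. sentence J \<and> refines J I}. M_fun J m)"

section \<open>Colored immaculate tableaux\<close>

text \<open>A filling of the diagram of \<open>J\<close> is the list of its rows from top to bottom; the box in
  row \<open>r\<close>, column \<open>k\<close> has entry \<open>T ! r ! k\<close> and color \<open>J ! r ! k\<close>.\<close>

definition CIT :: "'a list list \<Rightarrow> nat list list \<Rightarrow> bool" where
  "CIT J T \<longleftrightarrow> map length T = map length J
     \<and> (\<forall>e \<in> set (concat T). 1 \<le> e)
     \<and> (\<forall>row \<in> set T. sorted row)
     \<and> sorted_wrt (<) (map hd T)"

text \<open>\<open>type_word J T i\<close> is the word \<open>u_i\<close> of the type of \<open>T\<close>: the colors of the boxes with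
  entry \<open>i\<close>, from the lowest (last) row to the highest, left to right within rows.\<close>

definition type_word :: "'a list list \<Rightarrow> nat list list \<Rightarrow> nat \<Rightarrow> 'a list" where
  "type_word J T i =
     concat (map (\<lambda>(w, row). map fst (filter (\<lambda>(c, e). e = i) (zip w row))) (rev (zip J T)))"

definition max_entry :: "nat list list \<Rightarrow> nat" where
  "max_entry T = Max (insert 0 (set (concat T)))"

definition x_tableau :: "'a list list \<Rightarrow> nat list list \<Rightarrow> 'a monom" where
  "x_tableau J T = prod_list (map (\<lambda>i. xword (type_word J T i) i) [1..<Suc (max_entry T)])"

definition dual_immaculate :: "'a list list \<Rightarrow> 'a series" where
  "dual_immaculate J = monom_series {T. CIT J T} (x_tableau J)"

definition SCIT :: "'a list list \<Rightarrow> nat list list \<Rightarrow> bool" where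
  "SCIT J T \<longleftrightarrow> CIT J T \<and> distinct (concat T) \<and> set (concat T) = {1..sentence_size J}"

definition descent :: "nat list list \<Rightarrow> nat \<Rightarrow> bool" where
  "descent T i \<longleftrightarrow> (\<exists>r s. r < s \<and> s < length T \<and> i \<in> set (T ! r) \<and> Suc i \<in> set (T ! s))"

text \<open>\<open>co_upto J T i\<close> is the sentence read off from the entries \<open>1, \<dots>, i\<close>. In a standard
  tableau the word \<open>type_word J T i\<close> is the one-letter word formed by the color of entry \<open>i\<close>.\<close>

primrec co_upto :: "'a list list \<Rightarrow> nat list list \<Rightarrow> nat \<Rightarrow> 'a list list" where
  "co_upto J T 0 = []"
| "co_upto J T (Suc i) =
     (if i = 0 \<or> descent T i
      then co_upto J T i @ [type_word J T (Suc i)]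
      else butlast (co_upto J T i) @ [last (co_upto J T i) @ type_word J T (Suc i)])"

definition co :: "'a list list \<Rightarrow> nat list list \<Rightarrow> 'a list list" where
  "co J T = co_upto J T (sentence_size J)"

definition L :: "'a list list \<Rightarrow> 'a list list \<Rightarrow> nat" where
  "L I J = card {T. SCIT I T \<and> co I T = J}"

text \<open>The inverse of the matrix \<open>(L I J)\<close> indexed by the sentences over \<open>A\<close> of size \<open>n\<close>
  (extended by \<open>0\<close> so that it is unique as a function).\<close>

definition is_L_inverse :: "'a set \<Rightarrow> nat \<Rightarrow> ('a list list \<Rightarrow> 'a list list \<Rightarrow> int) \<Rightarrow> bool" where
  "is_L_inverse A n N \<longleftrightarrow>
     (\<forall>I \<in> sentences A n. \<forall>K \<in> sentences A n.
        (\<Sum>J \<in> sentences A n. int (L I J) * N J K) = (if I = K then 1 else 0)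
      \<and> (\<Sum>J \<in> sentences A n. N I J * int (L J K)) = (if I = K then 1 else 0))
   \<and> (\<forall>I K. I \<notin> sentences A n \<or> K \<notin> sentences A n \<longrightarrow> N I K = 0)"

definition L_inv :: "'a set \<Rightarrow> nat \<Rightarrow> 'a list list \<Rightarrow> 'a list list \<Rightarrow> int" where
  "L_inv A n = (THE N. is_L_inverse A n N)"

section \<open>The colored immaculate descent graph\<close>

definition descent_graph ::
    "'a set \<Rightarrow> nat \<Rightarrow> ('a list list, 'a list list \<times> 'a list list) pre_digraph" where
  "descent_graph A n =
     \<lparr> verts = sentences A n,
       arcs = {(I, J). I \<in> sentences A n \<and> J \<in> sentences A n \<and> J \<noteq> I
                 \<and> (\<exists>T. SCIT I T \<and> co I T = J)},
       tail = fst,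
       head = snd \<rparr>"

text \<open>Paths are lists of arcs; the weight of the arc \<open>(I, J)\<close> is \<open>L I J\<close>.\<close>

definition path_prod :: "('a list list \<times> 'a list list) list \<Rightarrow> int" where
  "path_prod p = prod_list (map (\<lambda>(I, J). int (L I J)) p)"

end

theory Submission
  imports Defs "HOL-Library.Multiset"
begin

text \<open>
  Standardizing a colored immaculate tableau of shape \<open>I\<close>, with equal entries ordered from the
  lowest row to the highest and from left to right within rows, writes it uniquely as a standard
  tableau \<open>U\<close> together with a weakly increasing sequence that rises strictly at every descent of
  \<open>U\<close>. Such sequences are counted by the monomials of \<open>F\<close> at \<open>co U\<close>, so
  the dual immaculate function of \<open>I\<close> is \<open>\<Sum>J. L I J * F J\<close>.

  In a standard tableau, an entry in row \<open>r\<close> is preceded by at least \<open>r\<close> descents (rows counted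
  from 0), because the first column increases downwards. Summing over all entries, the weight
  \<open>\<Sum>r. r * |w\<^sub>r|\<close> of a sentence grows strictly from \<open>I\<close> to \<open>co U\<close>
  unless \<open>co U = I\<close>, which happens for exactly one \<open>U\<close>. Hence \<open>L\<close> is unitriangular, the descent
  graph is acyclic, and splitting off the first or the last arc of a path shows that the signed path
  sums invert \<open>L\<close> on both sides.
\<close>

section \<open>Fundamental quasisymmetric functions as sums over index sequences\<close>

text \<open>Swaps only permute the letters, so the set of indices is well defined on classes. It
  serves finiteness: only finitely many index sequences yield a given monomial, so cardinalities are
  true multiplicities.\<close>

lift_definition monom_indices :: "'a monom \<Rightarrow> nat set" is "\<lambda>u. snd ` set u"
proof -
  fix u v :: "('a \<times> nat) list"
  assume "equivclp var_swap u v"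
  then show "snd ` set u = snd ` set v"
    by (induction rule: equivclp_induct) (auto elim!: var_swap.cases)
qed

lemma monom_indices_simps [simp]:
  "monom_indices 1 = {}"
  "monom_indices (x * y) = monom_indices x \<union> monom_indices y"
  "monom_indices (xvar a i) = {i}"
  by (transfer; auto)+

lemma finite_monom_indices: "finite (monom_indices m)"
  by transfer simp

lemma monom_indices_prod_list:
  "length c = length s \<Longrightarrow> monom_indices (prod_list (map2 xvar c s)) = set s"
  by (induction c s rule: list_induct2) auto

lemma finite_index_lists:
  "finite {s. length c = length s \<and> prod_list (map2 xvar c s) = m}"
proof (rule finite_subset)
  show "{s. length c = length s \<and> prod_list (map2 xvar c s) = m}
      \<subseteq> {s. set s \<subseteq> monom_indices m \<and> length s = length c}"
    using monom_indices_prod_list by fastforce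
  show "finite {s. set s \<subseteq> monom_indices m \<and> length s = length c}"
    using finite_lists_length_eq[OF finite_monom_indices] .
qed

section \<open>Index sequences of single letters\<close>

text \<open>The term of \<open>M_fun K\<close> at \<open>js\<close> gives every letter of the word
  \<open>K ! k\<close> the index \<open>js ! k\<close>. Listing the index of each single letter
  makes the terms of different refinements comparable.\<close>

definition spread :: "'a list list \<Rightarrow> 'b list \<Rightarrow> 'b list" where
  "spread K js = concat (map2 (\<lambda>w j. replicate (length w) j) K js)"

lemma spread_simps [simp]:
  "spread [] js = []"
  "spread (w # K) (j # js) = replicate (length w) j @ spread K js"
  by (simp_all add: spread_def)

lemma length_spread: "length K = length js \<Longrightarrow> length (spread K js) = length (concat K)"
  by (induction K js rule: list_induct2) auto

lemma set_spread: "length K = length js \<Longrightarrow> sentence K \<Longrightarrow> set (spread K js) = set js"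
proof (induction K js rule: list_induct2)
  case (Cons w K j js)
  then have "w \<noteq> []" "sentence K" by (auto simp: sentence_def)
  then show ?case using Cons.IH by simp
qed simp

lemma sorted_spread:
  fixes js :: "nat list"
  shows "length K = length js \<Longrightarrow> sentence K \<Longrightarrow> sorted_wrt (<) js \<Longrightarrow> sorted (spread K js)"
proof (induction K js rule: list_induct2)
  case (Cons w K j js)
  then show ?case
    using set_spread[of K js] by (auto simp: sorted_append sentence_def less_imp_le)
qed simp

lemma prod_list_xword:
  "length K = length js \<Longrightarrow> prod_list (map2 xword K js) = prod_list (map2 xvar (concat K) (spread K js))"
proof (induction K js rule: list_induct2)
  case (Cons w K j js)
  have "zip w (replicate (length w) j) = map (\<lambda>c. (c, j)) w"
    by (induction w) auto
  then show ?case using Cons by (simp add: xword_def o_def)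
qed simp

text \<open>The words of \<open>K\<close> are the maximal runs of equal indices, because
  \<open>js\<close> is strictly increasing and no word is empty; so both \<open>K\<close> and
  \<open>js\<close> can be read off from the sequence.\<close>

lemma spread_inj:
  fixes js :: "nat list"
  assumes "length K = length js" "length K' = length js'"
    and "sentence K" "sentence K'" "sorted_wrt (<) js" "sorted_wrt (<) js'"
    and "concat K = concat K'" "spread K js = spread K' js'"
  shows "K = K' \<and> js = js'"
  using assms
proof (induction K js arbitrary: K' js' rule: list_induct2)
  case Nil
  then show ?case by (cases K'; cases js') (auto simp: sentence_def)
next
  case (Cons w K j js)
  have w: "w \<noteq> []" "sentence K" using Cons.prems(2) by (auto simp: sentence_def)
  obtain w' L j' ls where K': "K' = w' # L" "js' = j' # ls" "w' \<noteq> []" "sentence L"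
    using Cons.prems w by (cases K'; cases js') (auto simp: sentence_def)
  have eq: "replicate (length w) j @ spread K js = replicate (length w') j' @ spread L ls"
    using Cons.prems K' by simp
  have j: "j = j'" using arg_cong[OF eq, of hd] w K' by (simp add: hd_append)
  have gt: "x > j" if "x \<in> set (spread K js) \<union> set (spread L ls)" for x
    using that Cons.hyps Cons.prems w K' j by (auto simp: set_spread)
  \<comment> \<open>All later indices exceed \<open>j\<close>, so the first run ends exactly with
    the first word and reveals its length.\<close>
  have "takeWhile (\<lambda>x. x = j) (spread K js) = []" "takeWhile (\<lambda>x. x = j) (spread L ls) = []"
    using gt by (simp_all add: takeWhile_eq_Nil_iff) (metis UnCI hd_in_set less_irrefl)+
  then have "length w = length w'"
    using arg_cong[OF eq, of "\<lambda>s. length (takeWhile (\<lambda>x. x = j) s)"] j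
    by (simp add: takeWhile_append)
  then show ?case
    using Cons.IH[of L ls] Cons.prems K' w j by auto
qed

text \<open>Cut \<open>c\<close> along the maximal runs of equal entries of
  \<open>s\<close>.\<close>

lemma spread_surj:
  fixes s :: "nat list"
  assumes "length c = length s" "sorted s"
  shows "\<exists>K js. sentence K \<and> length K = length js \<and> sorted_wrt (<) js \<and> concat K = c \<and> spread K js = s"
  using assms
proof (induction c s rule: list_induct2)
  case Nil
  have "sentence ([] :: 'a list list)" by (simp add: sentence_def)
  then show ?case by (intro exI[of _ "[]"]) auto
next
  case (Cons x c e s)
  then obtain K js where K: "sentence K" "length K = length js" "sorted_wrt (<) js" "concat K = c"
    "spread K js = s" by auto
  have ge: "\<forall>j \<in> set js. e \<le> j" using set_spread[of K js] K Cons.prems by auto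
  \<comment> \<open>The new letter joins the first word if that word carries the same index, and
    otherwise starts a word of its own.\<close>
  show ?case
  proof (cases "js \<noteq> [] \<and> hd js = e")
    case True
    then obtain w L ls where L: "K = w # L" "js = e # ls" using K by (cases K; cases js) auto
    show ?thesis
      using K L by (intro exI[of _ "(x # w) # L"] exI[of _ js]) (auto simp: sentence_def)
  next
    case False
    then have "\<forall>j \<in> set js. e < j"
      using ge K(3) by (cases js) (auto simp: less_le)
    then show ?thesis
      using K by (intro exI[of _ "[x] # K"] exI[of _ "e # js"]) (auto simp: sentence_def)
  qed
qed

section \<open>Ascents, breaks and refinement\<close>

text \<open>A rise is recorded by the number of entries before it, so that it can be compared with
  the cuts of a sentence and with the descents of a tableau.\<close>

definition ascents :: "nat list \<Rightarrow> nat set" where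
  "ascents s = {i. 0 < i \<and> i < length s \<and> s ! (i - 1) < s ! i}"

text \<open>The partial sums of the word lengths, including both ends 0 and the size; without the
  ends this is the usual descent set of the composition.\<close>

primrec breaks :: "'a list list \<Rightarrow> nat set" where
  "breaks [] = {0}"
| "breaks (w # K) = insert 0 ((+) (length w) ` breaks K)"

lemma ascents_replicate_append:
  assumes "0 < a" "s \<noteq> []" "\<And>x. x \<in> set s \<Longrightarrow> j < x"
  shows "ascents (replicate a j @ s) = insert a ((+) a ` ascents s)"
proof (rule set_eqI)
  fix i
  consider "i < a" | "i = a" | k where "i = a + Suc k" 
    by (metis linorder_neqE_nat less_imp_Suc_add add_Suc_right)
  then show "i \<in> ascents (replicate a j @ s) \<longleftrightarrow> i \<in> insert a ((+) a ` ascents s)"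
    using assms by cases (auto simp: ascents_def nth_append image_iff)
qed

lemma zero_in_breaks: "0 \<in> breaks K"
  by (cases K) auto

lemma ascents_replicate: "ascents (replicate a j) = {}"
  by (auto simp: ascents_def)

text \<open>Indices are constant on words and rise strictly between them; the two ends are removed
  because a rise has entries on both sides.\<close>

lemma ascents_spread:
  assumes "length K = length js" "sentence K" "sorted_wrt (<) js"
  shows "ascents (spread K js) = breaks K - {0, length (concat K)}"
  using assms
proof (induction K js rule: list_induct2)
  case (Cons w K j js)
  have w: "0 < length w" "sentence K" using Cons.prems by (auto simp: sentence_def)
  show ?case
  proof (cases "K = []")
    case True
    then show ?thesis using Cons by (auto simp: ascents_replicate)
  next
    case False
    have ne: "concat K \<noteq> []" using False w by (cases K) (auto simp: sentence_def)
    have "ascents (spread (w # K) (j # js)) = insert (length w) ((+) (length w) ` ascents (spread K js))"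
      using ne length_spread[OF Cons.hyps] set_spread[OF Cons.hyps w(2)] w Cons.prems
      by (simp, subst ascents_replicate_append) auto
    then show ?thesis
      using Cons.IH Cons.prems w ne zero_in_breaks[of K] by (auto simp: image_iff)
  qed
qed (auto simp: ascents_def)

lemma breaks_iff: "b \<in> breaks K \<longleftrightarrow> (\<exists>K1 K2. K = K1 @ K2 \<and> b = length (concat K1))"
proof (induction K arbitrary: b)
  case (Cons w K)
  show ?case
  proof
    assume "b \<in> breaks (w # K)"
    then have "b = 0 \<or> (\<exists>x. x \<in> breaks K \<and> b = length w + x)"
      unfolding breaks.simps insert_iff image_iff by blast
    then have "b = 0 \<or> (\<exists>K1 K2. K = K1 @ K2 \<and> b = length w + length (concat K1))"
      unfolding Cons.IH by blast
    then consider "b = 0" | K1 K2 where "K = K1 @ K2" "b = length w + length (concat K1)"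
      by blast
    then show "\<exists>K1 K2. w # K = K1 @ K2 \<and> b = length (concat K1)"
    proof cases
      case 1
      then show ?thesis by (intro exI[of _ "[]"] exI[of _ "w # K"]) simp
    next
      case (2 K1 K2)
      then show ?thesis by (intro exI[of _ "w # K1"] exI[of _ K2]) simp
    qed
  next
    assume "\<exists>K1 K2. w # K = K1 @ K2 \<and> b = length (concat K1)"
    then obtain K1 K2 where K: "w # K = K1 @ K2" "b = length (concat K1)" by blast
    show "b \<in> breaks (w # K)"
    proof (cases K1)
      case (Cons v K3)
      then have "length (concat K3) \<in> breaks K"
        using K(1) unfolding Cons.IH by auto
      then show ?thesis using K Cons by auto
    qed (use K(2) in simp)
  qed
qed auto

lemma concat_map_concat: "concat (map concat B) = concat (concat B)"
  by (induction B) auto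

lemma refines_imp_breaks: "refines K J \<Longrightarrow> breaks J \<subseteq> breaks K"
proof
  fix b assume "refines K J" "b \<in> breaks J"
  then obtain B J1 J2 where B: "K = concat B" "J = map concat B" "J = J1 @ J2" "b = length (concat J1)"
    by (auto simp: refines_def breaks_iff)
  then obtain B1 B2 where "B = B1 @ B2" "J1 = map concat B1"
    by (metis append_eq_map_conv)
  then show "b \<in> breaks K"
    using B unfolding breaks_iff
    by (intro exI[of _ "concat B1"] exI[of _ "concat B2"]) (simp add: concat_map_concat)
qed

text \<open>Peel off the first word \<open>w\<close> of \<open>J\<close>: since
  \<open>length w\<close> is a break of \<open>K\<close>, an initial block of words of
  \<open>K\<close> spells exactly \<open>w\<close>, and the remaining words refine the rest of
  \<open>J\<close>.\<close>

lemma breaks_imp_refines: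
  assumes "sentence K" "sentence J" "concat K = concat J" "breaks J \<subseteq> breaks K"
  shows "refines K J"
proof -
  have "\<exists>B. [] \<notin> set B \<and> K = concat B \<and> J = map concat B"
    using assms
  proof (induction J arbitrary: K)
    case Nil
    then show ?case by (intro exI[of _ "[]"]) (cases K; auto simp: sentence_def)
  next
    case (Cons w J)
    have w: "w \<noteq> []" "sentence J" using Cons.prems by (auto simp: sentence_def)
    have "length w \<in> breaks K" using Cons.prems(4) zero_in_breaks[of J] by auto
    then obtain K1 K2 where K: "K = K1 @ K2" "length w = length (concat K1)"
      by (auto simp: breaks_iff)
    then have c: "concat K1 = w" "concat K2 = concat J" using Cons.prems(3) by auto
    have s: "sentence K1" "sentence K2" using Cons.prems(1) K by (auto simp: sentence_def)
    have "breaks J \<subseteq> breaks K2"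
    proof
      fix b assume "b \<in> breaks J"
      then have "length w + b \<in> breaks K" using Cons.prems(4) by auto
      then obtain P Q where P: "K = P @ Q" "length w + b = length (concat P)"
        by (auto simp: breaks_iff)
      \<comment> \<open>\<open>P\<close> and \<open>K1\<close> are both prefixes of
        \<open>K\<close>. If \<open>P\<close> were the shorter one, it would have fewer letters than
        \<open>w\<close>, as words are nonempty.\<close>
      from P(1) K(1) consider us where "P = K1 @ us" "K2 = us @ Q" | us where "K1 = P @ us" "us \<noteq> []" 
        by (metis append_eq_append_conv2 append_Nil2)
      then show "b \<in> breaks K2"
      proof cases
        case 1 then show ?thesis using P K by (auto simp: breaks_iff)
      next
        case 2 then show ?thesis using P K s by (cases us) (auto simp: sentence_def)
      qed
    qed
    then obtain B where "[] \<notin> set B" "K2 = concat B" "J = map concat B"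
      using Cons.IH[of K2] s w c by auto
    then show ?case using K c w by (intro exI[of _ "K1 # B"]) auto
  qed
  then show ?thesis using assms by (simp add: refines_def)
qed

lemma length_le_concat: "sentence K \<Longrightarrow> length K \<le> length (concat K)"
proof (induction K)
  case (Cons w K)
  then show ?case by (cases w) (auto simp: sentence_def)
qed simp

lemma finite_sentences:
  assumes "finite A"
  shows "finite (sentences A n)"
proof -
  let ?W = "{w. set w \<subseteq> A \<and> length w \<le> n}"
  have "I \<in> {K. set K \<subseteq> ?W \<and> length K \<le> n}" if "I \<in> sentences A n" for I
  proof -
    have "length w \<le> n" if "w \<in> set I" for w
      using \<open>I \<in> sentences A n\<close> member_le_sum_list[of "length w" "map length I"] that
      by (auto simp: sentences_def sentence_size_def length_concat)
    then show ?thesis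
      using that length_le_concat[of I] by (auto simp: sentences_def sentence_size_def)
  qed
  then show ?thesis
    using finite_lists_length_le[OF finite_lists_length_le[OF assms]] by (meson finite_subset subsetI)
qed

text \<open>A term of \<open>M_fun K\<close> for a refinement \<open>K\<close> of \<open>J\<close>
  is a weakly increasing index sequence whose rises are exactly the interior breaks of
  \<open>K\<close>. Summing over all refinements leaves only the requirement that the sequence rises
  at the interior breaks of \<open>J\<close>.\<close>

lemma F_fun_eq_card:
  assumes "sentence J"
  shows "F_fun J m = int (card {s. length (concat J) = length s \<and> sorted s \<and> (\<forall>j \<in> set s. 1 \<le> j)
     \<and> breaks J - {0, length (concat J)} \<subseteq> ascents s \<and> prod_list (map2 xvar (concat J) s) = m})"
    (is "_ = int (card ?S)")
proof -
  let ?X = "{K. sentence K \<and> refines K J}"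
  let ?Y = "\<lambda>K. {js. (length js = length K \<and> sorted_wrt (<) js \<and> (\<forall>j \<in> set js. 1 \<le> j))
        \<and> prod_list (map2 xword K js) = m}"
  have K: "concat K = concat J" if "K \<in> ?X" for K
    using that by (auto simp: refines_def)
  have finX: "finite ?X"
    by (rule finite_subset[OF _ finite_sentences[of "set (concat J)" "length (concat J)"]])
      (use K in \<open>force simp: sentences_def sentence_size_def simp del: set_concat\<close>, rule finite_set)
  have inj: "inj_on (\<lambda>(K, js). spread K js) (Sigma ?X ?Y)"
  proof (rule inj_onI, clarify)
    fix K K' :: "'a list list" and js js' :: "nat list"
    assume "sentence K" "refines K J" "length js = length K" "sorted_wrt (<) js"
      "sentence K'" "refines K' J" "length js' = length K'" "sorted_wrt (<) js'"
      "spread K js = spread K' js'"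
    then show "K = K' \<and> js = js'"
      by (intro spread_inj) (auto simp: refines_def)
  qed
  have image: "(\<lambda>(K, js). spread K js) ` Sigma ?X ?Y = ?S"
  proof (intro set_eqI iffI)
    fix s assume "s \<in> (\<lambda>(K, js). spread K js) ` Sigma ?X ?Y"
    then obtain K js where *: "s = spread K js" "K \<in> ?X" "js \<in> ?Y K" by auto
    then have c: "concat K = concat J" using K by blast
    then show "s \<in> ?S"
      using * refines_imp_breaks[of K J] ascents_spread[of K js]
      by (auto simp: length_spread set_spread sorted_spread prod_list_xword)
  next
    fix s assume s: "s \<in> ?S"
    then obtain K js where *: "sentence K" "length K = length js" "sorted_wrt (<) js"
      "concat K = concat J" "spread K js = s" using spread_surj[of "concat J" s] by auto
    have "breaks J - {0, length (concat J)} \<subseteq> ascents s" using s by blast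
    also have "\<dots> = breaks K - {0, length (concat J)}"
      using ascents_spread[OF *(2,1,3)] by (simp only: *)
    finally have "breaks J - {0, length (concat J)} \<subseteq> breaks K - {0, length (concat J)}" .
    \<comment> \<open>The ends 0 and the size are breaks of both sentences, so the inclusion of
      interior breaks extends to all breaks.\<close>
    moreover have "length (concat K) \<in> breaks K"
      unfolding breaks_iff by (intro exI[of _ K] exI[of _ "[]"]) simp
    then have "{0, length (concat J)} \<subseteq> breaks K"
      using *(4) by (simp add: zero_in_breaks)
    ultimately have "breaks J \<subseteq> breaks K" by blast
    then have "refines K J"
      using *(1,4) assms by (intro breaks_imp_refines)
    then have "(K, js) \<in> Sigma ?X ?Y"
      using * s set_spread[of K js] by (auto simp: prod_list_xword)
    then show "s \<in> (\<lambda>(K, js). spread K js) ` Sigma ?X ?Y" using * by force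
  qed
  \<comment> \<open>The map into index sequences is injective, so finiteness transfers back to the
    pairs and from there to the terms of each single \<open>M_fun K\<close>.\<close>
  have "finite ?S"
    by (rule finite_subset[OF _ finite_index_lists[of "concat J" m]]) auto
  then have "finite ((\<lambda>(K, js). spread K js) ` Sigma ?X ?Y)" unfolding image .
  then have finXY: "finite (Sigma ?X ?Y)" using inj by (rule finite_imageD)
  have "finite (?Y K)" if "K \<in> ?X" for K
  proof -
    have "finite (Pair K ` ?Y K)"
      using that by (intro finite_subset[OF _ finXY]) auto
    then show ?thesis by (rule finite_imageD) (auto intro: inj_onI)
  qed
  then have "card (Sigma ?X ?Y) = (\<Sum>K\<in>?X. card (?Y K))"
    using finX by (intro card_SigmaI) auto
  then show ?thesis
    using card_image[OF inj] image by (simp add: F_fun_def M_fun_def monom_series_def)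
qed

section \<open>Standardization\<close>

text \<open>Boxes are pairs (row, column) counted from 0, listed in the order in which type words are read:
  from the last row to the first.\<close>

definition boxes :: "'b list list \<Rightarrow> (nat \<times> nat) list" where
  "boxes J = concat (map (\<lambda>r. map (Pair r) [0..<length (J ! r)]) (rev [0..<length J]))"

text \<open>Polymorphic, so that the same access to a box yields the entry in a tableau and the
  color in a sentence.\<close>

definition entry :: "'b list list \<Rightarrow> nat \<times> nat \<Rightarrow> 'b" where
  "entry T b = T ! fst b ! snd b"

text \<open>The order in which boxes with equal entries are read: lower rows, which have the larger
  index, come first.\<close>

definition before :: "nat \<times> nat \<Rightarrow> nat \<times> nat \<Rightarrow> bool" where
  "before p q \<longleftrightarrow> fst q < fst p \<or> fst p = fst q \<and> snd p < snd q"

lemma set_boxes: "set (boxes J) = {(r, c). r < length J \<and> c < length (J ! r)}"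
  by (auto simp: boxes_def)

lemma boxes_cong:
  assumes "map length T = map length J"
  shows "boxes T = boxes J"
proof -
  have len: "length T = length J" using arg_cong[OF assms, of length] by simp
  have "length (T ! r) = length (J ! r)" if "r < length J" for r
    using arg_cong[OF assms, of "\<lambda>l. l ! r"] that len by simp
  then show ?thesis
    unfolding boxes_def len by (intro arg_cong[of _ _ concat] map_cong) auto
qed

lemma sorted_boxes: "sorted_wrt before (boxes J)"
proof -
  have "sorted_wrt before (concat (map (\<lambda>r. map (Pair r) [0..<f r]) (rev [0..<k])))" for f and k :: nat
    by (induction k) (auto simp: sorted_wrt_append sorted_wrt_map before_def)
  then show ?thesis by (simp add: boxes_def)
qed

lemma distinct_boxes: "distinct (boxes J)"
proof -
  have "distinct (concat (map (\<lambda>r. map (Pair r) [0..<f r]) (rev [0..<k])))" for f and k :: nat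
    by (induction k) (auto simp: distinct_map inj_on_def)
  then show ?thesis by (simp add: boxes_def)
qed

lemma map_entry_boxes: "map (entry T) (boxes T) = concat (rev T)"
proof -
  have "map (\<lambda>r. map (\<lambda>c. T ! r ! c) [0..<length (T ! r)]) (rev [0..<length T]) = rev T"
    by (simp add: map_nth rev_map[symmetric])
  then show ?thesis
    by (simp add: boxes_def map_concat o_def entry_def)
qed

lemma length_boxes: "length (boxes J) = length (concat J)"
  using arg_cong[OF map_entry_boxes[of J], of length]
  by (simp add: length_concat rev_map[symmetric])

lemma entry_eqI:
  assumes "map length T = map length J" "map length T' = map length J"
    and "\<And>b. b \<in> set (boxes J) \<Longrightarrow> entry T b = entry T' b"
  shows "T = T'"
proof (rule nth_equalityI)
  show len: "length T = length T'" using assms(1,2) by (metis length_map)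
  fix r assume r: "r < length T"
  have lenJ: "length T = length J" using assms(1) by (metis length_map)
  have row: "length (T ! r) = length (J ! r)" "length (T' ! r) = length (J ! r)"
    using arg_cong[OF assms(1), of "\<lambda>l. l ! r"] arg_cong[OF assms(2), of "\<lambda>l. l ! r"] r len lenJ
    by simp_all
  show "T ! r = T' ! r"
    using row assms(3) r lenJ by (intro nth_equalityI) (auto simp: set_boxes entry_def)
qed

text \<open>Puts the tableau conditions in terms of boxes. Since words are nonempty, the head of
  each row is its box in column 0.\<close>

lemma CIT_iff:
  assumes "sentence J"
  shows "CIT J T \<longleftrightarrow> map length T = map length J \<and> (\<forall>b \<in> set (boxes J). 1 \<le> entry T b)
    \<and> (\<forall>b \<in> set (boxes J). \<forall>b' \<in> set (boxes J). fst b = fst b' \<and> snd b < snd b' \<longrightarrow> entry T b \<le> entry T b')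
    \<and> (\<forall>r r'. r < r' \<and> r' < length J \<longrightarrow> entry T (r, 0) < entry T (r', 0))"
proof (cases "map length T = map length J")
  case True
  have len: "length T = length J" using arg_cong[OF True, of length] by simp
  have row: "length (T ! r) = length (J ! r)" if "r < length J" for r
    using arg_cong[OF True, of "\<lambda>l. l ! r"] that len by simp
  have ne: "J ! r \<noteq> []" if "r < length J" for r
    using assms nth_mem[OF that] unfolding sentence_def by metis
  have "set (concat T) = set (map (entry T) (boxes T))" by (simp add: map_entry_boxes)
  then have 1: "(\<forall>e \<in> set (concat T). 1 \<le> e) \<longleftrightarrow> (\<forall>b \<in> set (boxes J). 1 \<le> entry T b)"
    by (simp add: boxes_cong[OF True])
  have 2: "(\<forall>w \<in> set T. sorted w) \<longleftrightarrow> (\<forall>b \<in> set (boxes J). \<forall>b' \<in> set (boxes J).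
      fst b = fst b' \<and> snd b < snd b' \<longrightarrow> entry T b \<le> entry T b')"
    by (simp add: all_set_conv_all_nth sorted_wrt_iff_nth_less set_boxes entry_def len row)
      (meson less_trans)
  have hd: "hd (T ! r) = entry T (r, 0)" if "r < length J" for r
    using row[OF that] ne[OF that] by (simp add: entry_def hd_conv_nth flip: length_greater_0_conv)
  have 3: "sorted_wrt (<) (map hd T) \<longleftrightarrow>
      (\<forall>r r'. r < r' \<and> r' < length J \<longrightarrow> entry T (r, 0) < entry T (r', 0))"
    by (auto simp: sorted_wrt_iff_nth_less len hd)
  show ?thesis unfolding CIT_def 1 2 3 using True by simp
qed (simp add: CIT_def)

lemma CIT_shape: "CIT J T \<Longrightarrow> map length T = map length J"
  by (simp add: CIT_def)

section \<open>Stable sorting and the reading order of a tableau\<close>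

text \<open>Sorting is stable: elements with equal key keep their order, and that order is governed
  by \<open>Q\<close>.\<close>

lemma sorted_wrt_sort_key:
  assumes "sorted_wrt Q xs"
  shows "sorted_wrt (\<lambda>x y. f x < f y \<or> f x = f y \<and> Q x y) (sort_key f xs)"
proof -
  have "sorted_wrt (\<lambda>x y. f x < f y \<or> f x = f y \<and> Q x y) ys"
    if "sorted (map f ys)" "\<And>k. sorted_wrt Q (filter (\<lambda>y. f y = k) ys)" for ys
    using that
  proof (induction ys)
    case (Cons a ys)
    have "sorted_wrt Q (filter (\<lambda>y. f y = k) ys)" for k
      using Cons.prems(2)[of k] by (auto split: if_splits)
    moreover have "f a < f y \<or> f a = f y \<and> Q a y" if "y \<in> set ys" for y
      using Cons.prems(1) Cons.prems(2)[of "f a"] that by (auto simp: less_le)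
    ultimately show ?case using Cons by auto
  qed simp
  from this[of "sort_key f xs"] show ?thesis
    using assms by (simp add: sort_key_stable sorted_wrt_filter)
qed

text \<open>Standardization numbers the boxes in this order: by entry, and by \<open>before\<close>
  among equal entries.\<close>

definition reading :: "nat list list \<Rightarrow> (nat \<times> nat) list" where
  "reading T = sort_key (entry T) (boxes T)"

lemma mset_reading: "map length T = map length J \<Longrightarrow> mset (reading T) = mset (boxes J)"
  by (simp add: reading_def boxes_cong[of T J])

lemma set_reading: "map length T = map length J \<Longrightarrow> set (reading T) = set (boxes J)"
  by (simp add: reading_def boxes_cong[of T J])

lemma distinct_reading: "distinct (reading T)"
  by (simp add: reading_def distinct_boxes)

lemma length_reading: "map length T = map length J \<Longrightarrow> length (reading T) = length (concat J)"
  by (simp add: reading_def boxes_cong[of T J] length_boxes)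

lemma sorted_reading:
  "sorted_wrt (\<lambda>x y. entry T x < entry T y \<or> entry T x = entry T y \<and> before x y) (reading T)"
  unfolding reading_def by (rule sorted_wrt_sort_key[OF sorted_boxes])

text \<open>In multiset form, standardness is insensitive to the order in which the boxes are
  listed.\<close>

lemma SCIT_iff:
  assumes "sentence J"
  shows "SCIT J T \<longleftrightarrow> CIT J T \<and> mset (map (entry T) (boxes J)) = mset [1..<Suc (length (concat J))]"
proof (cases "map length T = map length J")
  case True
  have "mset (map (entry T) (boxes J)) = mset (concat T)"
    unfolding boxes_cong[OF True, symmetric] map_entry_boxes by (induction T) (simp_all add: union_commute)
  moreover have "distinct (concat T) \<and> set (concat T) = {1..length (concat J)} \<longleftrightarrow>
      mset (concat T) = mset [1..<Suc (length (concat J))]" (is "?l \<longleftrightarrow> ?r")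
  proof -
    have set: "{1..length (concat J)} = set [1..<Suc (length (concat J))]" by auto
    show ?thesis
      unfolding set
      by (metis distinct_upt mset_eq_imp_distinct_iff mset_eq_setD set_eq_iff_mset_eq_distinct)
  qed
  ultimately show ?thesis by (simp only: SCIT_def sentence_size_def)
qed (simp add: SCIT_def CIT_def)

lemma map_entry_reading:
  assumes "sentence J" "SCIT J U" "mset R = mset (boxes J)" "sorted (map (entry U) R)"
  shows "map (entry U) R = [1..<Suc (length (concat J))]"
proof -
  have "mset (map (entry U) R) = mset [1..<Suc (length (concat J))]"
    using assms by (simp add: SCIT_iff)
  then show ?thesis
    using assms(4) by (metis properties_for_sort sorted_upt)
qed

lemma sorted_map_reading: "sorted (map (entry T) (reading T))"
  by (simp add: reading_def)

lemma reading_standard: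
  assumes "sentence J" "SCIT J U"
  shows "map (entry U) (reading U) = [1..<Suc (length (concat J))]"
    and "i < length (concat J) \<Longrightarrow> entry U (reading U ! i) = Suc i"
proof -
  have sh: "map length U = map length J" using assms by (simp add: SCIT_def CIT_def)
  show *: "map (entry U) (reading U) = [1..<Suc (length (concat J))]"
    by (rule map_entry_reading[OF assms mset_reading[OF sh] sorted_map_reading])
  show "entry U (reading U ! i) = Suc i" if "i < length (concat J)"
    using arg_cong[OF *, of "\<lambda>l. l ! i"] that length_reading[OF sh]
    by (simp del: upt_Suc)
qed

text \<open>Entries of a standard tableau are distinct, so only one ordering of the boxes sorts
  them.\<close>

lemma reading_standard_unique:
  assumes "sentence J" "SCIT J U" "mset R = mset (boxes J)" "sorted (map (entry U) R)"
  shows "R = reading U"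
proof -
  have sh: "map length U = map length J" using assms by (simp add: SCIT_def CIT_def)
  have eq: "map (entry U) R = map (entry U) (reading U)"
    using map_entry_reading[OF assms] reading_standard(1)[OF assms(1,2)] by simp
  have "distinct (map (entry U) (reading U))"
    by (simp only: reading_standard[OF assms(1,2)] distinct_upt)
  then have "inj_on (entry U) (set R \<union> set (reading U))"
    using mset_eq_setD[OF assms(3)] set_reading[OF sh] by (simp add: distinct_map)
  then show ?thesis using eq by (rule map_inj_on[rotated])
qed

text \<open>The position of a box in the reading order is its entry minus one, so a standard tableau
  amounts to its list of boxes.\<close>

lemma SCIT_eqI:
  assumes "sentence J" "SCIT J U" "SCIT J U'" "reading U = reading U'"
  shows "U = U'"
proof -
  have sh: "map length U = map length J" "map length U' = map length J"
    using assms by (simp_all add: SCIT_def CIT_def)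
  show ?thesis
  proof (rule entry_eqI[OF sh])
    fix b assume "b \<in> set (boxes J)"
    then obtain i where "i < length (concat J)" "b = reading U ! i"
      using set_reading[OF sh(1)] length_reading[OF sh(1)] by (metis in_set_conv_nth)
    then show "entry U b = entry U' b"
      using reading_standard(2) assms by metis
  qed
qed

section \<open>Relabelling a standard tableau by an index sequence\<close>

text \<open>If \<open>\<rho>\<close> is larger at \<open>j\<close> than at \<open>i\<close>, it
  rises at some adjacent step in between; \<open>s\<close> rises strictly there as well and never
  falls elsewhere.\<close>

lemma ascents_strict:
  assumes "length \<rho> = length s" "sorted s" "ascents \<rho> \<subseteq> ascents s"
    and "i < j" "j < length s" "\<rho> ! i < \<rho> ! j"
  shows "s ! i < s ! j"
  using assms(4-)
proof (induction j)
  case (Suc j)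
  have le: "s ! i \<le> s ! j" "s ! j \<le> s ! Suc j"
    using Suc.prems assms(2) by (auto simp: sorted_iff_nth_mono)
  show ?case
  proof (cases "\<rho> ! i < \<rho> ! j")
    case True
    then show ?thesis using Suc le by (cases "i = j") auto
  next
    case False
    then have "Suc j \<in> ascents \<rho>" using Suc.prems assms(1) by (auto simp: ascents_def)
    then have "s ! j < s ! Suc j" using assms(3) by (auto simp: ascents_def)
    then show ?thesis using le by simp
  qed
qed simp

text \<open>Inverts standardization: entry \<open>e\<close> is replaced by the \<open>e\<close>-th
  index of \<open>s\<close>, with \<open>e - 1\<close> because lists start at position 0.\<close>

definition relabel :: "nat list list \<Rightarrow> nat list \<Rightarrow> nat list list" where
  "relabel U s = map (map (\<lambda>e. s ! (e - 1))) U"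

lemma shape_relabel: "map length (relabel U s) = map length U"
  by (simp add: relabel_def o_def)

lemma entry_relabel: "b \<in> set (boxes U) \<Longrightarrow> entry (relabel U s) b = s ! (entry U b - 1)"
  by (auto simp: relabel_def entry_def set_boxes)

text \<open>For a standard tableau, the rows occupied by the entries 1, 2, ... in turn; its ascents
  turn out to be the descents of the tableau.\<close>

definition row_word :: "nat list list \<Rightarrow> nat list" where
  "row_word U = map fst (reading U)"

context
  fixes I :: "'a list list" and U :: "nat list list" and s :: "nat list"
  assumes I: "sentence I" and U: "SCIT I U"
    and s: "length (concat I) = length s" "sorted s" "ascents (row_word U) \<subseteq> ascents s"
begin

private lemma shU: "map length U = map length I"
  using U by (simp add: SCIT_def CIT_def)

private lemma shT: "map length (relabel U s) = map length I"
  using shU by (simp add: shape_relabel)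

private lemma box_index:
  assumes "b \<in> set (boxes I)"
  obtains i where "i < length s" "b = reading U ! i" "entry U b = Suc i"
    "entry (relabel U s) b = s ! i" "row_word U ! i = fst b"
proof -
  obtain i where i: "i < length s" "b = reading U ! i"
    using assms set_reading[OF shU] length_reading[OF shU] s(1) by (metis in_set_conv_nth)
  moreover from this have "entry U b = Suc i" using reading_standard(2)[OF I U] s(1) by simp
  ultimately show ?thesis
    using that assms entry_relabel[of b U s] length_reading[OF shU] s(1)
    by (simp add: boxes_cong[OF shU] row_word_def)
qed

private lemma row_strict:
  assumes "i < j" "j < length s" "row_word U ! i < row_word U ! j"
  shows "s ! i < s ! j"
proof (rule ascents_strict[OF _ s(2,3) assms])
  show "length (row_word U) = length s" using length_reading[OF shU] s(1) by (simp add: row_word_def)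
qed

text \<open>Boxes with equal labels never move to a lower row as the entries of \<open>U\<close>
  grow. This agrees with the tie-breaking of the reading order, so the boxes are read in the same
  order.\<close>

lemma reading_relabel: "reading (relabel U s) = reading U"
proof (rule reading_standard_unique[OF I U])
  show "mset (reading (relabel U s)) = mset (boxes I)"
    by (rule mset_reading[OF shT])
  let ?f = "entry (relabel U s)"
  have "entry U x \<le> entry U y" if "x \<in> set (reading (relabel U s))" "y \<in> set (reading (relabel U s))"
    "?f x < ?f y \<or> ?f x = ?f y \<and> before x y" for x y
  proof (rule ccontr)
    assume less: "\<not> entry U x \<le> entry U y"
    have xy: "x \<in> set (boxes I)" "y \<in> set (boxes I)" using that set_reading[OF shT] by auto
    obtain i where i: "i < length s" "entry U x = Suc i" "?f x = s ! i" "row_word U ! i = fst x"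
      using box_index[OF xy(1)] by metis
    obtain j where j: "j < length s" "entry U y = Suc j" "?f y = s ! j" "row_word U ! j = fst y"
      using box_index[OF xy(2)] by metis
    have ji: "j < i" using less i j by simp
    then have "s ! j \<le> s ! i" using s(2) i by (simp add: sorted_iff_nth_mono)
    then have eq: "s ! i = s ! j" "before x y" using that i j by auto
    \<comment> \<open>Equal labels rule out a rise of the row index from \<open>y\<close> to
      \<open>x\<close>. As \<open>x\<close> is read before \<open>y\<close>, both share a row, where
      the entries of \<open>U\<close> do not decrease.\<close>
    have "\<not> fst y < fst x" using row_strict[OF ji i(1)] i j eq by auto
    then have "fst x = fst y" "snd x < snd y" using eq(2) by (auto simp: before_def)
    then have "entry U x \<le> entry U y"
      using U I xy by (simp add: SCIT_def CIT_iff)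
    then show False using less by simp
  qed
  then show "sorted (map (entry U) (reading (relabel U s)))"
    unfolding sorted_wrt_map by (intro sorted_wrt_mono_rel[OF _ sorted_reading]) blast
qed

text \<open>Together with \<open>reading_relabel\<close>, this recovers both \<open>U\<close> and
  \<open>s\<close> from the relabelled tableau.\<close>

lemma map_entry_relabel: "map (entry (relabel U s)) (reading U) = s"
proof (rule nth_equalityI)
  show "length (map (entry (relabel U s)) (reading U)) = length s"
    using length_reading[OF shU] s(1) by simp
  fix i assume "i < length (map (entry (relabel U s)) (reading U))"
  then have i: "i < length (reading U)" by simp
  then have "reading U ! i \<in> set (boxes U)" using set_reading[of U U] nth_mem by blast
  then show "map (entry (relabel U s)) (reading U) ! i = s ! i"
    using i reading_standard(2)[OF I U, of i] length_reading[OF shU] by (simp add: entry_relabel)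
qed

text \<open>Rows stay weakly increasing because \<open>s\<close> is. Down the first column of
  \<open>U\<close> the entries grow while the row index rises, so the labels rise strictly.\<close>

lemma CIT_relabel:
  assumes "\<forall>j \<in> set s. 1 \<le> j"
  shows "CIT I (relabel U s)"
  unfolding CIT_iff[OF I]
proof (intro conjI ballI allI impI)
  show "map length (relabel U s) = map length I" by (rule shT)
next
  fix b assume "b \<in> set (boxes I)"
  then show "1 \<le> entry (relabel U s) b" using assms by (metis box_index nth_mem)
next
  fix b b' assume b: "b \<in> set (boxes I)" "b' \<in> set (boxes I)" "fst b = fst b' \<and> snd b < snd b'"
  then have "entry U b \<le> entry U b'" using U I by (simp add: SCIT_def CIT_iff)
  then show "entry (relabel U s) b \<le> entry (relabel U s) b'"
    using box_index[OF b(1)] box_index[OF b(2)] s(2) by (metis Suc_le_mono sorted_nth_mono)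
next
  fix r r' assume r: "r < r' \<and> r' < length I"
  then have "I ! r \<noteq> []" "I ! r' \<noteq> []" using I by (metis nth_mem sentence_def order.strict_trans)+
  then have b: "(r, 0) \<in> set (boxes I)" "(r', 0) \<in> set (boxes I)" using r by (auto simp: set_boxes)
  have less: "entry U (r, 0) < entry U (r', 0)" using r U I by (simp add: SCIT_def CIT_iff)
  obtain i where i: "i < length s" "entry U (r, 0) = Suc i" "entry (relabel U s) (r, 0) = s ! i"
      "row_word U ! i = r"
    using box_index[OF b(1)] by (metis fst_conv)
  obtain j where j: "j < length s" "entry U (r', 0) = Suc j" "entry (relabel U s) (r', 0) = s ! j"
      "row_word U ! j = r'"
    using box_index[OF b(2)] by (metis fst_conv)
  show "entry (relabel U s) (r, 0) < entry (relabel U s) (r', 0)"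
    using row_strict[of i j] i j less r by simp
qed

end

section \<open>Standardization of arbitrary tableaux\<close>

text \<open>Give box \<open>R ! i\<close> the entry \<open>Suc i\<close>. The assumptions
  \<open>rows\<close> and \<open>cols\<close> then become the tableau conditions.\<close>

lemma exists_standard:
  assumes I: "sentence I" and R: "distinct R" "set R = set (boxes I)"
    and rows: "\<And>i j. i < length R \<Longrightarrow> j < length R \<Longrightarrow> fst (R ! i) = fst (R ! j) \<Longrightarrow>
      snd (R ! i) < snd (R ! j) \<Longrightarrow> i < j"
    and cols: "\<And>i j. i < length R \<Longrightarrow> j < length R \<Longrightarrow> snd (R ! i) = 0 \<Longrightarrow> snd (R ! j) = 0 \<Longrightarrow>
      fst (R ! i) < fst (R ! j) \<Longrightarrow> i < j"
  shows "\<exists>U. SCIT I U \<and> reading U = R"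
proof -
  define pos where "pos = inv_into {..<length R} ((!) R)"
  have bij: "bij_betw ((!) R) {..<length R} (set R)" using R(1) by (intro bij_betw_nth) auto
  have pos: "pos b < length R" "R ! pos b = b" if "b \<in> set (boxes I)" for b
    using that bij R(2) unfolding pos_def
    by (metis bij_betw_imp_surj_on inv_into_into lessThan_iff)
      (metis bij bij_betw_inv_into_right R(2) that)
  have pos_nth: "pos (R ! i) = i" if "i < length R" for i
    using that bij unfolding pos_def by (simp add: bij_betw_inv_into_left)
  define U where "U = map (\<lambda>r. map (\<lambda>c. Suc (pos (r, c))) [0..<length (I ! r)]) [0..<length I]"
  have sh: "map length U = map length I"
    unfolding U_def by (rule nth_equalityI) auto
  have e: "entry U b = Suc (pos b)" if "b \<in> set (boxes I)" for b
    using that by (auto simp: U_def entry_def set_boxes)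
  have mR: "mset R = mset (boxes I)"
    using R distinct_boxes set_eq_iff_mset_eq_distinct by blast
  then have len: "length R = length (concat I)" by (metis length_boxes mset_eq_length)
  have map: "map (entry U) R = [1..<Suc (length (concat I))]"
  proof (rule nth_equalityI)
    fix i assume "i < length (map (entry U) R)"
    then show "map (entry U) R ! i = [1..<Suc (length (concat I))] ! i"
      using e[of "R ! i"] pos_nth[of i] nth_mem[of i R] R(2) len by (simp del: upt_Suc)
  qed (simp add: len del: upt_Suc)
  have "CIT I U"
    unfolding CIT_iff[OF I]
  proof (intro conjI ballI allI impI)
    fix b b' assume "b \<in> set (boxes I)" "b' \<in> set (boxes I)" "fst b = fst b' \<and> snd b < snd b'"
    then show "entry U b \<le> entry U b'"
      using rows[of "pos b" "pos b'"] pos e by simp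
  next
    fix r r' assume r: "r < r' \<and> r' < length I"
    then have "I ! r \<noteq> []" "I ! r' \<noteq> []" using I by (metis nth_mem sentence_def order.strict_trans)+
    then have "(r, 0) \<in> set (boxes I)" "(r', 0) \<in> set (boxes I)" using r by (auto simp: set_boxes)
    then show "entry U (r, 0) < entry U (r', 0)"
      using cols[of "pos (r, 0)" "pos (r', 0)"] pos e r by simp
  qed (use sh e in auto)
  then have "SCIT I U"
    unfolding SCIT_iff[OF I] using map mR by (metis mset_map)
  moreover have "R = reading U"
    using map by (intro reading_standard_unique[OF I \<open>SCIT I U\<close> mR]) (simp only: sorted_upt)
  ultimately show ?thesis by blast
qed

text \<open>\<open>U\<close> numbers the boxes in the reading order of \<open>T\<close>, and
  \<open>s\<close> lists the entries of \<open>T\<close> in that order.\<close>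

lemma standardization:
  assumes I: "sentence I" and T: "CIT I T"
  shows "\<exists>U s. SCIT I U \<and> length (concat I) = length s \<and> sorted s \<and> (\<forall>j \<in> set s. 1 \<le> j)
    \<and> ascents (row_word U) \<subseteq> ascents s \<and> relabel U s = T"
proof -
  have sh: "map length T = map length I" using T by (rule CIT_shape)
  let ?R = "reading T"
  have len: "length ?R = length (concat I)" by (rule length_reading[OF sh])
  have box: "?R ! i \<in> set (boxes I)" if "i < length ?R" for i
    using that set_reading[OF sh] nth_mem by blast
  have ord: "entry T (?R ! i) < entry T (?R ! j) \<or> entry T (?R ! i) = entry T (?R ! j) \<and> before (?R ! i) (?R ! j)"
    if "i < j" "j < length ?R" for i j
    using sorted_wrt_nth_less[OF sorted_reading that] .
  have "\<exists>U. SCIT I U \<and> reading U = ?R"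
  proof (rule exists_standard[OF I distinct_reading set_reading[OF sh]])
    fix i j assume *: "i < length ?R" "j < length ?R" "fst (?R ! i) = fst (?R ! j)" "snd (?R ! i) < snd (?R ! j)"
    then have "entry T (?R ! i) \<le> entry T (?R ! j)" using T I box by (simp add: CIT_iff)
    then show "i < j"
      using ord[of j i] * by (cases i j rule: linorder_cases) (auto simp: before_def)
  next
    fix i j assume *: "i < length ?R" "j < length ?R" "snd (?R ! i) = 0" "snd (?R ! j) = 0"
      "fst (?R ! i) < fst (?R ! j)"
    then have "(fst (?R ! i), 0) = ?R ! i" "(fst (?R ! j), 0) = ?R ! j" by (metis prod.collapse)+
    moreover have "fst (?R ! j) < length I" using box[OF *(2)] by (auto simp: set_boxes)
    ultimately have "entry T (?R ! i) < entry T (?R ! j)" using T I *(5) unfolding CIT_iff[OF I] by metis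
    then show "i < j"
      using ord[of j i] * by (cases i j rule: linorder_cases) auto
  qed
  then obtain U where U: "SCIT I U" "reading U = ?R" by blast
  have shU: "map length U = map length I" using U by (simp add: SCIT_def CIT_def)
  define s where "s = map (entry T) ?R"
  have s: "length (concat I) = length s" "sorted s" by (simp_all only: s_def len length_map sorted_map_reading)
  have pos: "\<forall>j \<in> set s. 1 \<le> j" using T I set_reading[OF sh] by (auto simp: s_def CIT_iff)
  \<comment> \<open>Among equal entries the reading order goes upwards or stays in the row, so a
    step to a lower row forces a strictly larger entry.\<close>
  have asc: "ascents (row_word U) \<subseteq> ascents s"
  proof
    fix i assume "i \<in> ascents (row_word U)"
    then have i: "0 < i" "i < length ?R" "fst (?R ! (i - 1)) < fst (?R ! i)"
      by (auto simp: ascents_def row_word_def U)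
    then show "i \<in> ascents s"
      using ord[of "i - 1" i] by (auto simp: ascents_def s_def before_def)
  qed
  have "relabel U s = T"
  proof (rule entry_eqI[of _ I])
    show "map length (relabel U s) = map length I" using shU by (simp add: shape_relabel)
    fix b assume "b \<in> set (boxes I)"
    then have b: "b \<in> set ?R" using set_reading[OF sh] by simp
    have "map (entry (relabel U s)) ?R = map (entry T) ?R"
      using map_entry_relabel[OF I U(1) s asc] U(2) s_def by simp
    then show "entry (relabel U s) b = entry T b" using b by (simp only: map_eq_conv)
  qed (rule sh)
  then show ?thesis using U(1) s pos asc by blast
qed

section \<open>The monomial of a tableau along its reading order\<close>

text \<open>\<open>boxes\<close> runs from the last row up, exactly as type words are read, so all
  type words are filters of one list.\<close>

lemma type_word_boxes:
  assumes "map length T = map length J"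
  shows "type_word J T i = map (entry J) (filter (\<lambda>b. entry T b = i) (boxes J))"
proof -
  have len: "length T = length J" using arg_cong[OF assms, of length] by simp
  have row: "length (T ! r) = length (J ! r)" if "r < length J" for r
    using arg_cong[OF assms, of "\<lambda>l. l ! r"] that len by simp
  have zip: "zip J T = map (\<lambda>r. (J ! r, T ! r)) [0..<length J]"
    by (rule nth_equalityI) (auto simp: len)
  have row_eq: "map fst (filter (\<lambda>(c, e). e = i) (zip (J ! r) (T ! r)))
      = map (entry J) (filter (\<lambda>b. entry T b = i) (map (Pair r) [0..<length (J ! r)]))"
    if "r < length J" for r
  proof -
    have "zip (J ! r) (T ! r) = map (\<lambda>c. (J ! r ! c, T ! r ! c)) [0..<length (J ! r)]"
      using row[OF that] by (intro nth_equalityI) auto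
    then show ?thesis by (simp add: filter_map o_def entry_def)
  qed
  have "map (\<lambda>r. map fst (filter (\<lambda>(c, e). e = i) (zip (J ! r) (T ! r)))) (rev [0..<length J])
    = map (\<lambda>r. map (entry J) (filter (\<lambda>b. entry T b = i) (map (Pair r) [0..<length (J ! r)]))) (rev [0..<length J])"
    by (rule map_cong) (simp_all only: row_eq set_rev set_upt atLeastLessThan_iff)
  from arg_cong[OF this, of concat] show ?thesis
    by (simp only: type_word_def zip boxes_def rev_map map_map o_def filter_concat map_concat prod.case)
qed

text \<open>Collecting the level sets one after the other is a stable sort.\<close>

lemma concat_filter_levels:
  fixes f :: "'b \<Rightarrow> nat"
  shows "concat (map (\<lambda>i. filter (\<lambda>x. f x = i) xs) [0..<m]) = filter (\<lambda>x. f x < m) (sort_key f xs)"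
proof (induction m)
  case (Suc m)
  have "filter (\<lambda>x. f x < Suc m) ys = filter (\<lambda>x. f x < m) ys @ filter (\<lambda>x. f x = m) ys"
    if "sorted (map f ys)" for ys
    using that
  proof (induction ys)
    case (Cons y ys)
    have "filter (\<lambda>x. f x < m) ys = []" if "f y = m"
      using Cons.prems that by (auto simp: filter_empty_conv)
    then show ?case using Cons by auto
  qed simp
  from this[of "sort_key f xs"] show ?case by (simp add: Suc sort_key_stable)
qed simp

lemma prod_list_concat: "prod_list (concat xss) = prod_list (map prod_list xss)"
  by (induction xss) auto

text \<open>The type words, taken for increasing entries, concatenate to the colors along the
  reading order.\<close>

lemma x_tableau_reading:
  assumes I: "sentence I" and T: "CIT I T"
  shows "x_tableau I T = prod_list (map2 xvar (map (entry I) (reading T)) (map (entry T) (reading T)))"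
proof -
  have sh: "map length T = map length I" using T by (rule CIT_shape)
  have pos: "1 \<le> entry T b" if "b \<in> set (boxes I)" for b using T I that by (simp add: CIT_iff)
  have le: "entry T b \<le> max_entry T" if "b \<in> set (boxes I)" for b
  proof -
    have "entry T b \<in> set (map (entry T) (boxes T))" using that boxes_cong[OF sh] by simp
    then have "entry T b \<in> set (concat T)" unfolding map_entry_boxes by simp
    then show ?thesis unfolding max_entry_def by (intro Max_ge) auto
  qed
  \<comment> \<open>Entries are positive, so the empty level 0 can be added to match the range in
    \<open>concat_filter_levels\<close>.\<close>
  have "filter (\<lambda>b. entry T b = 0) (boxes I) = []"
    using pos by (fastforce simp: filter_empty_conv)
  then have "concat (map (\<lambda>i. filter (\<lambda>b. entry T b = i) (boxes I)) [1..<Suc (max_entry T)])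
    = concat (map (\<lambda>i. filter (\<lambda>b. entry T b = i) (boxes I)) [0..<Suc (max_entry T)])"
    by (simp add: upt_conv_Cons del: upt_Suc)
  also have "\<dots> = filter (\<lambda>x. entry T x < Suc (max_entry T)) (reading T)"
    unfolding concat_filter_levels reading_def boxes_cong[OF sh] ..
  also have "\<dots> = reading T"
    using le set_reading[OF sh] by (auto simp: filter_id_conv less_Suc_eq_le)
  finally have R: "concat (map (\<lambda>i. filter (\<lambda>b. entry T b = i) (boxes I)) [1..<Suc (max_entry T)]) = reading T" .
  have "xword (type_word I T i) i
      = prod_list (map (\<lambda>b. xvar (entry I b) (entry T b)) (filter (\<lambda>b. entry T b = i) (boxes I)))" for i
    unfolding xword_def type_word_boxes[OF sh] map_map o_def
    by (intro arg_cong[of _ _ prod_list] map_cong) auto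
  then have "x_tableau I T = prod_list (map (\<lambda>b. xvar (entry I b) (entry T b))
      (concat (map (\<lambda>i. filter (\<lambda>b. entry T b = i) (boxes I)) [1..<Suc (max_entry T)])))"
    unfolding x_tableau_def by (simp add: map_concat prod_list_concat o_def del: upt_Suc)
  then show ?thesis unfolding R by (simp add: zip_map_map zip_same_conv_map o_def case_prod_unfold)
qed

section \<open>Descent compositions and unitriangularity\<close>

text \<open>Mirrors \<open>co_upto\<close> with the descents of a tableau replaced by the ascents of
  a list, so that the recursion can be analysed without tableaux.\<close>

primrec ascent_cut :: "nat list \<Rightarrow> 'a list \<Rightarrow> nat \<Rightarrow> 'a list list" where
  "ascent_cut \<rho> c 0 = []"
| "ascent_cut \<rho> c (Suc i) =
     (if i = 0 \<or> i \<in> ascents \<rho> then ascent_cut \<rho> c i @ [[c ! i]]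
      else butlast (ascent_cut \<rho> c i) @ [last (ascent_cut \<rho> c i) @ [c ! i]])"

text \<open>For each letter of the sentence, the index of the word containing it, counted from
  0.\<close>

definition blocks :: "'a list list \<Rightarrow> nat list" where
  "blocks J = spread J [0..<length J]"

text \<open>The index of the word containing position \<open>i\<close> when a list is cut at the
  ascents of \<open>\<rho>\<close>.\<close>

definition block :: "nat list \<Rightarrow> nat \<Rightarrow> nat" where
  "block \<rho> i = card (ascents \<rho> \<inter> {..i})"

lemma block_Suc: "block \<rho> (Suc i) = block \<rho> i + (if Suc i \<in> ascents \<rho> then 1 else 0)"
  by (simp add: block_def atMost_Suc)

lemma block_0: "block \<rho> 0 = 0"
  by (simp add: block_def ascents_def)

lemma spread_snoc:
  "length K = length js \<Longrightarrow> spread (K @ [w]) (js @ [j]) = spread K js @ replicate (length w) j"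
  by (simp add: spread_def)

lemma blocks_snoc: "blocks (K @ [w]) = blocks K @ replicate (length w) (length K)"
  by (simp add: blocks_def spread_snoc)

lemma ascent_cut_nonempty: "0 < i \<Longrightarrow> ascent_cut \<rho> c i \<noteq> []"
  by (cases i) auto

lemma sentence_ascent_cut: "sentence (ascent_cut \<rho> c i)"
  by (induction i) (auto simp: sentence_def dest: in_set_butlastD)

lemma concat_ascent_cut: "i \<le> length c \<Longrightarrow> concat (ascent_cut \<rho> c i) = take i c"
proof (induction i)
  case (Suc i)
  have "concat (butlast K @ [last K @ [x]]) = concat K @ [x]" if "K \<noteq> []" for K and x :: 'a
    using that by (induction K) auto
  then show ?case
    using Suc ascent_cut_nonempty[of i \<rho> c] by (auto simp: take_Suc_conv_app_nth)
qed simp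

text \<open>A new word starts exactly when the block index grows. The length is carried along
  because it is the index that the next word receives.\<close>

lemma blocks_ascent_cut:
  "blocks (ascent_cut \<rho> c i) = map (block \<rho>) [0..<i] \<and> (0 < i \<longrightarrow> length (ascent_cut \<rho> c i) = Suc (block \<rho> (i - 1)))"
proof (induction i)
  case 0
  then show ?case by (simp add: blocks_def)
next
  case (Suc i)
  show ?case
  proof (cases "i = 0 \<or> i \<in> ascents \<rho>")
    case True
    then have cut: "ascent_cut \<rho> c (Suc i) = ascent_cut \<rho> c i @ [[c ! i]]" by simp
    have "length (ascent_cut \<rho> c i) = block \<rho> i"
      using Suc True block_Suc[of \<rho> "i - 1"] by (cases "i = 0") (auto simp: block_0)
    then show ?thesis using Suc unfolding cut by (simp add: blocks_snoc)
  next
    case False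
    define K where "K = butlast (ascent_cut \<rho> c i)"
    define w where "w = last (ascent_cut \<rho> c i)"
    have cut: "ascent_cut \<rho> c i = K @ [w]" using False ascent_cut_nonempty[of i \<rho> c] by (simp add: K_def w_def)
    have cut': "ascent_cut \<rho> c (Suc i) = K @ [w @ [c ! i]]" using False by (simp add: K_def w_def)
    have i: "block \<rho> (i - 1) = block \<rho> i" using False block_Suc[of \<rho> "i - 1"] by simp
    then have "length K = block \<rho> i" using Suc False cut by simp
    moreover have "blocks (K @ [w @ [c ! i]]) = blocks (K @ [w]) @ [length K]"
      by (simp add: blocks_snoc replicate_append_same)
    ultimately show ?thesis using Suc cut i unfolding cut' by simp
  qed
qed

lemma sorted_block: "sorted (map (block \<rho>) [0..<n])"
  by (auto simp: sorted_iff_nth_mono block_def intro!: card_mono)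

lemma ascents_block: "ascents (map (block \<rho>) [0..<length \<rho>]) = ascents \<rho>"
proof -
  have "block \<rho> (i - 1) < block \<rho> i \<longleftrightarrow> i \<in> ascents \<rho>" if "0 < i" for i
    using block_Suc[of \<rho> "i - 1"] that by auto
  then show ?thesis unfolding ascents_def[of "map _ _"] by (auto simp: ascents_def)
qed

lemma breaks_blocks: "sentence J \<Longrightarrow> breaks J - {0, length (concat J)} = ascents (blocks J)"
  unfolding blocks_def by (rule ascents_spread[symmetric]) auto

lemma blocks_inj:
  assumes "sentence J" "sentence K" "concat J = concat K" "blocks J = blocks K"
  shows "J = K"
  using spread_inj[of J "[0..<length J]" K "[0..<length K]"] assms by (simp add: blocks_def)

lemma SCIT_shape: "SCIT I U \<Longrightarrow> map length U = map length I"
  by (simp add: SCIT_def CIT_def)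

lemma length_row_word: "SCIT I U \<Longrightarrow> length (row_word U) = length (concat I)"
  by (simp add: row_word_def length_reading SCIT_shape)

lemma standard_box_iff:
  assumes "sentence I" "SCIT I U" "i < length (concat I)" "b \<in> set (boxes I)"
  shows "entry U b = Suc i \<longleftrightarrow> b = reading U ! i"
proof
  assume "entry U b = Suc i"
  obtain k where "k < length (concat I)" "b = reading U ! k"
    using assms set_reading[OF SCIT_shape] length_reading[OF SCIT_shape] by (metis in_set_conv_nth)
  then show "b = reading U ! i" using reading_standard(2)[OF assms(1,2)] \<open>entry U b = Suc i\<close> by simp
qed (use reading_standard(2)[OF assms(1,2)] assms in simp)

lemma type_word_standard:
  assumes "sentence I" "SCIT I U" "i < length (concat I)"
  shows "type_word I U (Suc i) = [entry I (reading U ! i)]"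
proof -
  have "reading U ! i \<in> set (boxes I)"
    using set_reading[OF SCIT_shape] length_reading[OF SCIT_shape] assms by (metis nth_mem)
  then have "set (filter (\<lambda>b. entry U b = Suc i) (boxes I)) = {reading U ! i}"
    unfolding set_filter using standard_box_iff[OF assms] by blast
  moreover have "ys = [y]" if "set ys = {y}" "distinct ys" for y and ys :: "(nat \<times> nat) list"
    using that by (cases ys) (auto simp: subset_singleton_iff)
  ultimately have "filter (\<lambda>b. entry U b = Suc i) (boxes I) = [reading U ! i]"
    by (simp add: distinct_boxes)
  then show ?thesis by (simp add: type_word_boxes[OF SCIT_shape[OF assms(2)]])
qed

text \<open>Entries \<open>i\<close> and \<open>Suc i\<close> sit at positions \<open>i - 1\<close>
  and \<open>i\<close> of the reading order.\<close>

lemma descent_iff: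
  assumes "sentence I" "SCIT I U" "0 < i" "i < length (concat I)"
  shows "descent U i \<longleftrightarrow> i \<in> ascents (row_word U)"
proof -
  have sh: "map length U = map length I" using assms(2) by (rule SCIT_shape)
  have mem: "Suc k \<in> set (U ! r) \<and> r < length U \<longleftrightarrow> fst (reading U ! k) = r" if "k < length (concat I)" for k r
  proof
    assume "Suc k \<in> set (U ! r) \<and> r < length U"
    then obtain c where "c < length (U ! r)" "U ! r ! c = Suc k" "r < length U"
      by (auto simp: in_set_conv_nth)
    then have "(r, c) \<in> set (boxes I)" "entry U (r, c) = Suc k"
      using boxes_cong[OF sh] by (auto simp: set_boxes entry_def simp flip: boxes_cong[OF sh])
    then show "fst (reading U ! k) = r" using standard_box_iff[OF assms(1,2) that] by (metis fst_conv)
  next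
    assume r: "fst (reading U ! k) = r"
    have "reading U ! k \<in> set (boxes U)"
      using set_reading[of U U] length_reading[OF sh] that by (metis nth_mem)
    then show "Suc k \<in> set (U ! r) \<and> r < length U"
      using reading_standard(2)[OF assms(1,2) that] r
      by (auto simp: set_boxes entry_def) (metis nth_mem)
  qed
  have "descent U i \<longleftrightarrow> (\<exists>r s. r < s \<and> (i \<in> set (U ! r) \<and> r < length U) \<and> (Suc i \<in> set (U ! s) \<and> s < length U))"
    unfolding descent_def by (meson order.strict_trans)
  also have "\<dots> \<longleftrightarrow> fst (reading U ! (i - 1)) < fst (reading U ! i)"
    using mem[of "i - 1"] mem[of i] assms by simp
  also have "\<dots> \<longleftrightarrow> i \<in> ascents (row_word U)"
    using assms length_reading[OF sh] by (auto simp: ascents_def row_word_def)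
  finally show ?thesis .
qed

lemma co_eq_ascent_cut:
  assumes "sentence I" "SCIT I U"
  shows "co I U = ascent_cut (row_word U) (map (entry I) (reading U)) (length (concat I))"
proof -
  have "co_upto I U k = ascent_cut (row_word U) (map (entry I) (reading U)) k" if "k \<le> length (concat I)" for k
    using that
  proof (induction k)
    case (Suc k)
    then have "k = 0 \<or> descent U k \<longleftrightarrow> k = 0 \<or> k \<in> ascents (row_word U)"
      using descent_iff[OF assms, of k] by auto
    then show ?case
      using Suc type_word_standard[OF assms, of k] length_reading[OF SCIT_shape[OF assms(2)]] by simp
  qed simp
  then show ?thesis by (simp add: co_def sentence_size_def)
qed

lemma sentence_co:
  assumes "sentence I" "SCIT I U"
  shows "sentence (co I U)" "concat (co I U) = map (entry I) (reading U)"
    "blocks (co I U) = map (block (row_word U)) [0..<length (concat I)]"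
    "breaks (co I U) - {0, length (concat I)} = ascents (row_word U)"
proof -
  show s: "sentence (co I U)" unfolding co_eq_ascent_cut[OF assms] by (rule sentence_ascent_cut)
  show c: "concat (co I U) = map (entry I) (reading U)"
    unfolding co_eq_ascent_cut[OF assms]
    by (subst concat_ascent_cut) (simp_all add: length_reading[OF SCIT_shape[OF assms(2)]])
  show b: "blocks (co I U) = map (block (row_word U)) [0..<length (concat I)]"
    unfolding co_eq_ascent_cut[OF assms] using blocks_ascent_cut by blast
  have "length (concat (co I U)) = length (concat I)"
    unfolding c by (simp add: length_reading[OF SCIT_shape[OF assms(2)]])
  then show "breaks (co I U) - {0, length (concat I)} = ascents (row_word U)"
    using breaks_blocks[OF s] b ascents_block[of "row_word U"] length_row_word[OF assms(2)] by simp
qed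

lemma co_in_sentences:
  assumes "I \<in> sentences A n" "SCIT I U"
  shows "co I U \<in> sentences A n"
proof -
  have I: "sentence I" using assms(1) by (simp add: sentences_def)
  have sh: "map length U = map length I" using assms(2) by (rule SCIT_shape)
  have "set (concat (co I U)) = set (map (entry I) (boxes I))"
    unfolding sentence_co[OF I assms(2)] by (simp add: set_reading[OF sh])
  also have "\<dots> = set (concat I)" unfolding map_entry_boxes by simp
  finally show ?thesis
    using assms(1) sentence_co[OF I assms(2)] length_reading[OF sh]
    by (simp add: sentences_def sentence_size_def del: set_concat)
qed

section \<open>Expansion of dual immaculate functions in the functions F\<close>

lemma finite_SCIT:
  assumes "sentence I"
  shows "finite {U. SCIT I U}"
proof (rule finite_imageD)
  show "inj_on reading {U. SCIT I U}"
    using SCIT_eqI[OF assms] by (auto intro: inj_onI)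
  have "reading ` {U. SCIT I U} \<subseteq> {R. set R \<subseteq> set (boxes I) \<and> length R = length (concat I)}"
    using set_reading[OF SCIT_shape] length_reading[OF SCIT_shape] by blast
  then show "finite (reading ` {U. SCIT I U})"
    using finite_lists_length_eq[of "set (boxes I)"] finite_subset by blast
qed

text \<open>Relabelling is a bijection from pairs of a standard tableau \<open>U\<close> and an
  admissible sequence \<open>s\<close> onto all tableaux, and \<open>s\<close> records the indices
  of the monomial. For fixed \<open>U\<close> the sequences are those counted by
  \<open>F_fun (co I U)\<close>.\<close>

lemma dual_immaculate_sum:
  assumes I: "sentence I"
  shows "dual_immaculate I m = (\<Sum>U \<in> {U. SCIT I U}. F_fun (co I U) m)"
proof -
  let ?S = "\<lambda>U. {s. length (concat I) = length s \<and> sorted s \<and> (\<forall>j \<in> set s. 1 \<le> j)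
     \<and> ascents (row_word U) \<subseteq> ascents s \<and> prod_list (map2 xvar (map (entry I) (reading U)) s) = m}"
  let ?X = "Sigma {U. SCIT I U} ?S"
  let ?T = "{T. CIT I T \<and> x_tableau I T = m}"
  have F: "F_fun (co I U) m = int (card (?S U))" if "SCIT I U" for U
  proof -
    have "length (concat (co I U)) = length (concat I)"
      unfolding sentence_co[OF I that] by (simp add: length_reading[OF SCIT_shape[OF that]])
    then show ?thesis
      using F_fun_eq_card[OF sentence_co(1)[OF I that]] sentence_co[OF I that] by simp
  qed
  have x: "x_tableau I (relabel U s) = prod_list (map2 xvar (map (entry I) (reading U)) s)"
    if "SCIT I U" "length (concat I) = length s" "sorted s" "\<forall>j \<in> set s. 1 \<le> j"
      "ascents (row_word U) \<subseteq> ascents s" for U s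
    unfolding x_tableau_reading[OF I CIT_relabel[OF I that(1,2,3,5,4)]]
      reading_relabel[OF I that(1,2,3,5)] map_entry_relabel[OF I that(1,2,3,5)] ..
  have inj: "inj_on (\<lambda>(U, s). relabel U s) ?X"
  proof (rule inj_onI, clarify)
    fix U s U' s'
    assume U: "SCIT I U" "length (concat I) = length s" "sorted s" "ascents (row_word U) \<subseteq> ascents s"
      and U': "SCIT I U'" "length (concat I) = length s'" "sorted s'" "ascents (row_word U') \<subseteq> ascents s'"
      and eq: "relabel U s = relabel U' s'"
    have "reading U = reading U'"
      using reading_relabel[OF I U] reading_relabel[OF I U'] eq by simp
    moreover have "s = s'"
      using map_entry_relabel[OF I U] map_entry_relabel[OF I U'] eq calculation by simp
    ultimately show "U = U' \<and> s = s'" using SCIT_eqI[OF I U(1) U'(1)] by simp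
  qed
  have image: "(\<lambda>(U, s). relabel U s) ` ?X = ?T"
  proof (intro set_eqI iffI)
    fix T assume "T \<in> (\<lambda>(U, s). relabel U s) ` ?X"
    then show "T \<in> ?T" using x CIT_relabel[OF I] by auto
  next
    fix T assume T: "T \<in> ?T"
    then obtain U s where U: "SCIT I U" "length (concat I) = length s" "sorted s" "\<forall>j \<in> set s. 1 \<le> j"
      "ascents (row_word U) \<subseteq> ascents s" "relabel U s = T"
      using standardization[OF I] by blast
    then have "(U, s) \<in> ?X" using x[OF U(1-5)] T by auto
    then show "T \<in> (\<lambda>(U, s). relabel U s) ` ?X" using U(6) by force
  qed
  have "finite (?S U)" if "SCIT I U" for U
    by (rule finite_subset[OF _ finite_index_lists[of "map (entry I) (reading U)" m]])
      (auto simp: length_reading[OF SCIT_shape[OF that]])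
  then have "card ?X = (\<Sum>U\<in>{U. SCIT I U}. card (?S U))"
    using finite_SCIT[OF I] by (intro card_SigmaI) auto
  moreover have "card ?T = card ?X" using card_image[OF inj] image by simp
  ultimately have "dual_immaculate I m = (\<Sum>U\<in>{U. SCIT I U}. int (card (?S U)))"
    by (simp add: dual_immaculate_def monom_series_def)
  then show ?thesis using F by simp
qed

text \<open>Groups the standard tableaux by their descent composition.\<close>

lemma dual_immaculate_expansion:
  assumes "finite A" "I \<in> sentences A n"
  shows "dual_immaculate I m = (\<Sum>J \<in> sentences A n. int (L I J) * F_fun J m)"
proof -
  have I: "sentence I" using assms(2) by (simp add: sentences_def)
  have "(\<Sum>J\<in>sentences A n. \<Sum>U\<in>{U \<in> {U. SCIT I U}. co I U = J}. F_fun (co I U) m)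
      = (\<Sum>U\<in>{U. SCIT I U}. F_fun (co I U) m)"
    using finite_SCIT[OF I] finite_sentences[OF assms(1)] co_in_sentences[OF assms(2)]
    by (intro sum.group) auto
  then show ?thesis
    unfolding dual_immaculate_sum[OF I] by (simp add: L_def)
qed

section \<open>Weights and unitriangularity\<close>

text \<open>Equals the sum of \<open>r\<close> times the length of word \<open>r\<close>, words
  counted from 0. It is the quantity along which \<open>L\<close> is triangular.\<close>

definition weight :: "'a list list \<Rightarrow> nat" where
  "weight J = sum_list (blocks J)"

text \<open>Rows from top to bottom, opposite to \<open>boxes\<close>: the reading order of the
  standard tableau filled row by row.\<close>

definition lex_boxes :: "'a list list \<Rightarrow> (nat \<times> nat) list" where
  "lex_boxes J = concat (map (\<lambda>r. map (Pair r) [0..<length (J ! r)]) [0..<length J])"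

lemma blocks_eq: "blocks J = map fst (lex_boxes J)"
proof -
  have "zip J [0..<length J] = map (\<lambda>r. (J ! r, r)) [0..<length J]"
    by (rule nth_equalityI) auto
  moreover have "map fst (map (Pair r) [0..<k]) = replicate k r" for r k :: nat
    by (simp add: o_def map_replicate_const)
  ultimately show ?thesis
    by (simp add: blocks_def spread_def lex_boxes_def map_concat o_def)
qed

lemma map_entry_lex_boxes: "map (entry J) (lex_boxes J) = concat J"
proof -
  have "map (\<lambda>r. map (\<lambda>c. J ! r ! c) [0..<length (J ! r)]) [0..<length J] = J"
    by (simp add: map_nth)
  then show ?thesis by (simp add: lex_boxes_def map_concat o_def entry_def)
qed

lemma mset_lex_boxes: "mset (lex_boxes J) = mset (boxes J)"
proof -
  have "mset (concat (map f [0..<k])) = mset (concat (map f (rev [0..<k])))" for k and f :: "nat \<Rightarrow> (nat \<times> nat) list"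
    by (induction k) auto
  then show ?thesis by (simp add: lex_boxes_def boxes_def)
qed

lemma sorted_lex_boxes:
  "sorted_wrt (\<lambda>p q. fst p < fst q \<or> fst p = fst q \<and> snd p < snd q) (lex_boxes J)"
proof -
  have "sorted_wrt (\<lambda>p q. fst p < fst q \<or> fst p = fst q \<and> snd p < snd q)
    (concat (map (\<lambda>r. map (Pair r) [0..<f r]) [0..<k]))" for f and k :: nat
    by (induction k) (auto simp: sorted_wrt_append sorted_wrt_map)
  then show ?thesis by (simp add: lex_boxes_def)
qed

text \<open>The row word is a rearrangement of \<open>blocks I\<close>, as both list the row of
  every box once.\<close>

lemma sum_list_row_word:
  assumes "SCIT I U"
  shows "sum_list (row_word U) = weight I"
proof -
  have "mset (row_word U) = mset (blocks I)"
    by (simp add: row_word_def blocks_eq mset_lex_boxes mset_reading[OF SCIT_shape[OF assms]])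
  then show ?thesis unfolding weight_def by (metis sum_mset_sum_list)
qed

text \<open>An entry in row \<open>Suc q\<close> exceeds the first entry of row \<open>q\<close>,
  because the first column increases. From the one to the other the row index rises, so a descent
  lies between them, and induction applies to the earlier entry.\<close>

lemma row_word_le_block:
  assumes I: "sentence I" and U: "SCIT I U" and "i < length (concat I)"
  shows "row_word U ! i \<le> block (row_word U) i"
  using assms(3)
proof (induction i rule: less_induct)
  case (less i)
  have sh: "map length U = map length I" using U by (rule SCIT_shape)
  have len: "length (reading U) = length (concat I)" by (rule length_reading[OF sh])
  show ?case
  proof (cases "row_word U ! i")
    case (Suc q)
    obtain c where c: "reading U ! i = (Suc q, c)"
      using Suc less.prems len by (cases "reading U ! i") (simp add: row_word_def)
    have bi: "(Suc q, c) \<in> set (boxes I)"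
      using c less.prems len set_reading[OF sh] by (metis nth_mem)
    then have q: "Suc q < length I" by (simp add: set_boxes)
    then have "I ! q \<noteq> []" "I ! Suc q \<noteq> []"
      using I by (metis Suc_lessD nth_mem sentence_def)+
    then have bq: "(q, 0) \<in> set (boxes I)" "(Suc q, 0) \<in> set (boxes I)"
      using q by (auto simp: set_boxes)
    obtain j where j: "j < length (concat I)" "reading U ! j = (q, 0)"
      using bq(1) len set_reading[OF sh] by (metis in_set_conv_nth)
    have CIT: "CIT I U" using U by (simp add: SCIT_def)
    then have "entry U (q, 0) < entry U (Suc q, 0)" using q by (simp add: CIT_iff[OF I])
    also have "entry U (Suc q, 0) \<le> entry U (Suc q, c)"
      using CIT bi bq unfolding CIT_iff[OF I] by (cases "c = 0") auto
    finally have "j < i"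
      using reading_standard(2)[OF I U j(1)] reading_standard(2)[OF I U less.prems] j c by simp
    then have "q \<le> block (row_word U) j"
      using less.IH[of j] j len by (simp add: row_word_def)
    \<comment> \<open>The block sequence has the same ascents as the row word, so a rise of rows
      forces a rise of blocks.\<close>
    moreover have "block (row_word U) j < block (row_word U) i"
      using ascents_strict[of "row_word U" "map (block (row_word U)) [0..<length (row_word U)]" j i]
        \<open>j < i\<close> less.prems j c len
      by (simp add: sorted_block ascents_block) (simp add: row_word_def)
    ultimately show ?thesis using Suc by simp
  qed simp
qed

text \<open>Sums the bound of \<open>row_word_le_block\<close> over all entries; equal sums force
  equality at every position.\<close>

lemma weight_co:
  assumes I: "sentence I" and U: "SCIT I U"
  shows "weight I \<le> weight (co I U)"
    and "weight (co I U) = weight I \<Longrightarrow> row_word U = blocks (co I U)"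
proof -
  let ?n = "length (concat I)" and ?\<rho> = "row_word U"
  have \<rho>: "weight I = (\<Sum>i<?n. ?\<rho> ! i)"
    unfolding sum_list_row_word[OF U, symmetric] sum_list_sum_nth length_row_word[OF U]
    by (simp add: atLeast0LessThan)
  have b: "weight (co I U) = (\<Sum>i<?n. block ?\<rho> i)"
    unfolding weight_def sentence_co[OF I U] by (simp add: sum_list_sum_nth atLeast0LessThan)
  show "weight I \<le> weight (co I U)"
    unfolding \<rho> b by (intro sum_mono row_word_le_block[OF I U]) simp
  assume "weight (co I U) = weight I"
  then have "?\<rho> ! i = block ?\<rho> i" if "i < ?n" for i
    using sum_mono_inv[of "(!) ?\<rho>" "{..<?n}" "block ?\<rho>" i] row_word_le_block[OF I U] that \<rho> b by simp
  then show "?\<rho> = blocks (co I U)"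
    unfolding sentence_co[OF I U] using length_row_word[OF U] by (intro nth_equalityI) auto
qed

text \<open>Both lists run left to right inside each row, so stable sorting by row only reorders the
  rows.\<close>

lemma sort_key_fst_boxes: "sort_key fst (boxes J) = lex_boxes J"
proof (rule properties_for_sort_key)
  show "mset (lex_boxes J) = mset (boxes J)" by (rule mset_lex_boxes)
  show "sorted (map fst (lex_boxes J))"
    unfolding sorted_wrt_map by (rule sorted_wrt_mono_rel[OF _ sorted_lex_boxes]) auto
  fix p :: "nat \<times> nat"
  have eq: "filter (\<lambda>q. fst p = fst q) (map (Pair r) [0..<k]) = (if fst p = r then map (Pair r) [0..<k] else [])"
    for r k :: nat by auto
  \<comment> \<open>The result depends only on how often \<open>a\<close> occurs in
    \<open>xs\<close>, hence agrees for the ascending and the reversed list of rows.\<close>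
  have "concat (map (\<lambda>r. if a = r then f r else []) xs) = concat (replicate (count_list xs a) (f a))"
    for a :: nat and xs and f :: "nat \<Rightarrow> (nat \<times> nat) list"
    by (induction xs) auto
  then show "filter (\<lambda>q. fst p = fst q) (lex_boxes J) = filter (\<lambda>q. fst p = fst q) (boxes J)"
    by (simp add: lex_boxes_def boxes_def filter_concat o_def eq count_list_rev)
qed

text \<open>Inside a row of \<open>U\<close> the reading order runs from left to right, because rows
  do not decrease; with sorted row indices it must go row by row.\<close>

lemma reading_sorted_rows:
  assumes I: "sentence I" and U: "SCIT I U" and sorted: "sorted (row_word U)"
  shows "reading U = lex_boxes I"
proof -
  have sh: "map length U = map length I" using U by (rule SCIT_shape)
  have "sort_key fst (boxes I) = reading U"
  proof (rule properties_for_sort_key)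
    show "mset (reading U) = mset (boxes I)" by (rule mset_reading[OF sh])
    show "sorted (map fst (reading U))" using sorted by (simp add: row_word_def)
    fix p :: "nat \<times> nat"
    let ?B = "filter (\<lambda>q. fst p = fst q) (boxes I)"
    have "sorted_wrt (\<lambda>x y. entry U x \<le> entry U y) ?B"
    proof (rule sorted_wrt_mono_rel[OF _ sorted_wrt_filter[OF sorted_boxes]])
      fix x y assume "x \<in> set ?B" "y \<in> set ?B" "before x y"
      then show "entry U x \<le> entry U y"
        using U I by (auto simp: SCIT_def CIT_iff before_def)
    qed
    then have "sort_key (entry U) ?B = ?B" by (simp add: sort_key_id_if_sorted sorted_wrt_map)
    then show "filter (\<lambda>q. fst p = fst q) (reading U) = ?B"
      by (simp add: reading_def filter_sort boxes_cong[OF sh])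
  qed
  then show ?thesis by (simp add: sort_key_fst_boxes)
qed

lemma sorted_blocks: "sentence J \<Longrightarrow> sorted (blocks J)"
  unfolding blocks_def by (intro sorted_spread) auto

text \<open>Each ascent raises a sorted row word by at least one, so block indices are at most row
  indices; \<open>row_word_le_block\<close> gives the converse.\<close>

lemma co_sorted_rows:
  assumes I: "sentence I" and U: "SCIT I U" and sorted: "sorted (row_word U)"
  shows "co I U = I"
proof -
  let ?\<rho> = "row_word U"
  have le: "block ?\<rho> i \<le> ?\<rho> ! i" if "i < length ?\<rho>" for i
    using that
  proof (induction i)
    case (Suc i)
    have "?\<rho> ! i \<le> ?\<rho> ! Suc i" using sorted Suc.prems by (simp add: sorted_iff_nth_mono)
    then show ?case using Suc by (auto simp: block_Suc ascents_def)
  qed (simp add: block_0)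
  have R: "reading U = lex_boxes I" by (rule reading_sorted_rows[OF assms])
  have "blocks (co I U) = ?\<rho>"
    unfolding sentence_co[OF I U]
    using le row_word_le_block[OF I U] length_row_word[OF U]
    by (intro nth_equalityI) (auto intro: antisym)
  then have "blocks (co I U) = blocks I" by (simp add: row_word_def R blocks_eq)
  moreover have "concat (co I U) = concat I"
    unfolding sentence_co[OF I U] R map_entry_lex_boxes ..
  ultimately show ?thesis using sentence_co(1)[OF I U] I by (intro blocks_inj)
qed

text \<open>At equal weight the row word consists of the block indices of \<open>co I U\<close>,
  hence is sorted, and then \<open>co I U = I\<close>.\<close>

lemma weight_co_less:
  assumes "sentence I" "SCIT I U" "co I U \<noteq> I"
  shows "weight I < weight (co I U)"
  using weight_co[OF assms(1,2)] co_sorted_rows[OF assms(1,2)] sorted_blocks[OF sentence_co(1)[OF assms(1,2)]]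
    assms(3) by (metis le_neq_implies_less)

text \<open>The only such tableau is the one filled row by row: equality of weights forces every
  candidate to have the sorted row word \<open>blocks I\<close>.\<close>

lemma L_diag:
  assumes I: "sentence I"
  shows "L I I = 1"
proof -
  let ?R = "lex_boxes I"
  have ord: "fst (?R ! i) < fst (?R ! j) \<or> fst (?R ! i) = fst (?R ! j) \<and> snd (?R ! i) < snd (?R ! j)"
    if "i < j" "j < length ?R" for i j
    using sorted_wrt_nth_less[OF sorted_lex_boxes that] .
  have "\<exists>U. SCIT I U \<and> reading U = ?R"
  proof (rule exists_standard[OF I])
    show "distinct ?R" using mset_lex_boxes distinct_boxes by (metis mset_eq_imp_distinct_iff)
    show "set ?R = set (boxes I)" using mset_lex_boxes by (metis mset_eq_setD)
  next
    fix i j assume "i < length ?R" "j < length ?R" "fst (?R ! i) = fst (?R ! j)" "snd (?R ! i) < snd (?R ! j)"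
    then show "i < j" using ord[of j i] by (cases i j rule: linorder_cases) auto
  next
    fix i j assume "i < length ?R" "j < length ?R" "fst (?R ! i) < fst (?R ! j)"
    then show "i < j" using ord[of j i] by (cases i j rule: linorder_cases) auto
  qed
  then obtain U where U: "SCIT I U" "reading U = ?R" by blast
  then have "sorted (row_word U)" using sorted_blocks[OF I] by (simp add: row_word_def blocks_eq)
  then have "co I U = I" by (rule co_sorted_rows[OF I U(1)])
  moreover have "T = U" if "SCIT I T" "co I T = I" for T
  proof -
    have "row_word T = blocks I" using weight_co(2)[OF I that(1)] that(2) by simp
    then have "reading T = ?R"
      using reading_sorted_rows[OF I that(1)] sorted_blocks[OF I] by simp
    then show ?thesis using SCIT_eqI[OF I that(1) U(1)] U(2) by simp
  qed
  ultimately have "{T. SCIT I T \<and> co I T = I} = {U}" using U(1) by blast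
  then show ?thesis by (simp add: L_def)
qed

text \<open>Finiteness makes a vanishing cardinality mean an empty set; this identifies arcs with
  nonzero off-diagonal entries of \<open>L\<close>.\<close>

lemma L_nonzero_iff:
  assumes "sentence I"
  shows "L I J \<noteq> 0 \<longleftrightarrow> (\<exists>T. SCIT I T \<and> co I T = J)"
proof -
  have "finite {T. SCIT I T \<and> co I T = J}"
    using finite_SCIT[OF assms] by (rule rev_finite_subset) auto
  then show ?thesis by (auto simp: L_def)
qed

section \<open>Path sums in the descent graph\<close>

lemma sum_delta_mult:
  fixes f :: "'b \<Rightarrow> int"
  assumes "finite V" "K \<in> V"
  shows "(\<Sum>J\<in>V. (if K = J then 1 else 0) * f J) = f K"
    and "(\<Sum>J\<in>V. f J * (if J = K then 1 else 0)) = f K"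
proof -
  have "(if K = J then 1 else 0) * f J = (if J = K then f J else 0)"
    "f J * (if J = K then 1 else 0) = (if J = K then f J else 0)" for J by auto
  then show "(\<Sum>J\<in>V. (if K = J then 1 else 0) * f J) = f K"
    "(\<Sum>J\<in>V. f J * (if J = K then 1 else 0)) = f K"
    using assms by (simp_all only: sum.delta if_True)
qed

abbreviation path_sum :: "'a set \<Rightarrow> nat \<Rightarrow> 'a list list \<Rightarrow> 'a list list \<Rightarrow> int" where
  "path_sum A n I K \<equiv>
     \<Sum>p \<in> {p. pre_digraph.apath (descent_graph A n) I p K}. (-1) ^ length p * path_prod p"

context
  fixes A :: "'a set" and n :: nat
  assumes finite_A: "finite A"
begin

private abbreviation (input) G where "G \<equiv> descent_graph A n"
private abbreviation (input) V where "V \<equiv> sentences A n"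

private lemma finite_V: "finite V"
  using finite_A by (rule finite_sentences)

private lemma arcs_iff: "e \<in> arcs G \<longleftrightarrow> fst e \<in> V \<and> snd e \<in> V \<and> snd e \<noteq> fst e \<and> L (fst e) (snd e) \<noteq> 0"
proof (cases e)
  case (Pair I J)
  then show ?thesis using L_nonzero_iff[of I J] by (auto simp: descent_graph_def sentences_def)
qed

private lemma graph_simps: "verts G = V" "tail G = fst" "head G = snd"
  by (simp_all add: descent_graph_def)

private lemma fin_digraph_G: "fin_digraph G"
proof
  show "finite (verts G)" using finite_V by (simp add: graph_simps)
  have "arcs G \<subseteq> V \<times> V" using arcs_iff by auto
  then show "finite (arcs G)" using finite_V by (meson finite_SigmaI finite_subset)
qed (auto simp: graph_simps arcs_iff)

interpretation G: fin_digraph G by (rule fin_digraph_G)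

private lemma weight_arc: "e \<in> arcs G \<Longrightarrow> weight (fst e) < weight (snd e)"
  by (auto simp: descent_graph_def sentences_def intro!: weight_co_less)

private lemma weight_awalk: "G.awalk I p K \<Longrightarrow> J \<in> set (G.awalk_verts I p) \<Longrightarrow> weight I \<le> weight J"
proof (induction p arbitrary: I)
  case (Cons e p)
  then have e: "e \<in> arcs G" "I = fst e" "G.awalk (snd e) p K"
    by (simp_all add: G.awalk_Cons_iff graph_simps)
  have "J = I \<or> J \<in> set (G.awalk_verts (snd e) p)"
    using Cons.prems(2) e(2) by (simp add: graph_simps)
  then show ?case
    using Cons.IH[OF e(3)] weight_arc[OF e(1)] e(2) by (auto dest: less_imp_le order.trans)
qed (simp add: G.awalk_Nil_iff)

text \<open>Weights increase strictly along arcs, so no vertex can repeat. Walks are easier to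
  extend at either end, as no distinctness has to be maintained.\<close>

private lemma apath_iff_awalk: "G.apath I p K \<longleftrightarrow> G.awalk I p K"
proof
  assume "G.awalk I p K"
  then show "G.apath I p K"
  proof (induction p arbitrary: I)
    case Nil
    then show ?case by (simp add: G.apath_def)
  next
    case (Cons e p)
    then have e: "e \<in> arcs G" "I = fst e" "G.awalk (snd e) p K"
      by (simp_all add: G.awalk_Cons_iff graph_simps)
    then have "I \<notin> set (G.awalk_verts (snd e) p)"
      using weight_awalk[OF e(3)] weight_arc[OF e(1)] by fastforce
    then show ?case
      using Cons e(2) Cons.IH[OF e(3)] by (simp add: G.apath_def graph_simps)
  qed
qed (simp add: G.apath_def)

private abbreviation (input) W where "W \<equiv> path_sum A n"

private lemma N_eq: "W I K = (\<Sum>p | G.awalk I p K. (-1) ^ length p * path_prod p)"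
  by (simp add: apath_iff_awalk)

private lemma finite_awalks: "finite {p. G.awalk I p K}"
  using G.apaths_finite[of I K] by (simp add: apath_iff_awalk)

private lemma N_zero: "I \<notin> V \<or> K \<notin> V \<Longrightarrow> W I K = 0"
proof -
  assume "I \<notin> V \<or> K \<notin> V"
  then have "{p. G.awalk I p K} = {}"
    using G.awalk_hd_in_verts G.awalk_last_in_verts by (auto simp: graph_simps)
  then show ?thesis unfolding N_eq by simp
qed

private lemma awalk_Nil: "{p. G.awalk I p K \<and> p = []} = (if I = K \<and> I \<in> V then {[]} else {})"
  by (auto simp: G.awalk_Nil_iff graph_simps)

private lemma L_outside: "I \<in> V \<Longrightarrow> J \<in> V \<Longrightarrow> J \<noteq> I \<Longrightarrow> (I, J) \<notin> arcs G \<Longrightarrow> L I J = 0"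
  by (simp add: arcs_iff)

text \<open>Split off the first arc \<open>(I, J)\<close>: it contributes the factor
  \<open>L I J\<close> and one sign.\<close>

private lemma N_first_step:
  assumes "I \<in> V" "K \<in> V"
  shows "W I K = (if I = K then 1 else 0) - (\<Sum>J \<in> V - {I}. int (L I J) * W J K)"
proof -
  let ?f = "\<lambda>p :: ('a list list \<times> 'a list list) list. (-1) ^ length p * path_prod p"
  let ?S = "{J. (I, J) \<in> arcs G}"
  let ?P = "\<lambda>J. Cons (I, J) ` {p. G.awalk J p K}"
  have split: "{p. G.awalk I p K} = {p. G.awalk I p K \<and> p = []} \<union> (\<Union>J\<in>?S. ?P J)"
  proof (intro set_eqI)
    fix p show "p \<in> {p. G.awalk I p K} \<longleftrightarrow> p \<in> {p. G.awalk I p K \<and> p = []} \<union> (\<Union>J\<in>?S. ?P J)"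
    proof (cases p)
      case (Cons e q)
      then show ?thesis
        by (cases e) (auto simp: G.awalk_Cons_iff graph_simps image_iff)
    qed auto
  qed
  have S: "?S \<subseteq> V - {I}" by (auto simp: arcs_iff)
  then have finS: "finite ?S" using finite_V finite_subset by blast
  have "W I K = sum ?f {p. G.awalk I p K \<and> p = []} + sum ?f (\<Union>J\<in>?S. ?P J)"
    unfolding N_eq split using finS finite_awalks
    by (intro sum.union_disjoint) (auto simp flip: split)
  also have "sum ?f {p. G.awalk I p K \<and> p = []} = (if I = K then 1 else 0)"
    unfolding awalk_Nil using assms by (simp add: path_prod_def)
  also have "sum ?f (\<Union>J\<in>?S. ?P J) = (\<Sum>J\<in>?S. sum ?f (?P J))"
    using finS finite_awalks by (intro sum.UNION_disjoint) auto
  also have "\<dots> = (\<Sum>J\<in>?S. - (int (L I J) * W J K))"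
  proof (rule sum.cong)
    fix J
    have "sum ?f (?P J) = (\<Sum>p | G.awalk J p K. ?f ((I, J) # p))"
      by (subst sum.reindex) auto
    also have "\<dots> = - (int (L I J) * W J K)"
      unfolding N_eq sum_distrib_left sum_negf[symmetric]
      by (intro sum.cong) (auto simp: path_prod_def)
    finally show "sum ?f (?P J) = - (int (L I J) * W J K)" .
  qed simp
  \<comment> \<open>Pairs of distinct vertices that are not arcs have \<open>L I J = 0\<close>, so
    the sum extends from the successors of \<open>I\<close> to all other vertices.\<close>
  also have "\<dots> = (\<Sum>J\<in>V - {I}. - (int (L I J) * W J K))"
    using S finite_V L_outside[OF assms(1)] by (intro sum.mono_neutral_left) auto
  finally show ?thesis by (simp add: sum_negf)
qed

text \<open>Split off the last arc instead; this supplies the inverse from the other side.\<close>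

private lemma N_last_step:
  assumes "I \<in> V" "K \<in> V"
  shows "W I K = (if I = K then 1 else 0) - (\<Sum>J \<in> V - {K}. W I J * int (L J K))"
proof -
  let ?f = "\<lambda>p :: ('a list list \<times> 'a list list) list. (-1) ^ length p * path_prod p"
  let ?S = "{J. (J, K) \<in> arcs G}"
  let ?P = "\<lambda>J. (\<lambda>p. p @ [(J, K)]) ` {p. G.awalk I p J}"
  have last: "G.awalk I (q @ [e]) K \<longleftrightarrow> e \<in> arcs G \<and> snd e = K \<and> G.awalk I q (fst e)" for q e
  proof
    assume "G.awalk I (q @ [e]) K"
    then show "e \<in> arcs G \<and> snd e = K \<and> G.awalk I q (fst e)"
      by (auto simp: G.awalk_Cons_iff G.awalk_Nil_iff graph_simps)
  next
    assume e: "e \<in> arcs G \<and> snd e = K \<and> G.awalk I q (fst e)"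
    then have "G.awlast I q = fst e" by (auto simp: G.awalk_def G.awlast_if_cas)
    moreover have "G.awalk (fst e) [e] K"
      using e assms by (simp add: G.awalk_Cons_iff G.awalk_Nil_iff graph_simps)
    ultimately show "G.awalk I (q @ [e]) K" using e by (simp only: G.awalk_append_iff)
  qed
  have split: "{p. G.awalk I p K} = {p. G.awalk I p K \<and> p = []} \<union> (\<Union>J\<in>?S. ?P J)"
  proof (intro set_eqI)
    fix p show "p \<in> {p. G.awalk I p K} \<longleftrightarrow> p \<in> {p. G.awalk I p K \<and> p = []} \<union> (\<Union>J\<in>?S. ?P J)"
    proof (cases p rule: rev_cases)
      case (snoc q e)
      then show ?thesis
        by (cases e) (auto simp: last image_iff simp del: G.awalk_append_iff)
    qed auto
  qed
  have S: "?S \<subseteq> V - {K}" by (auto simp: arcs_iff)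
  then have finS: "finite ?S" using finite_V finite_subset by blast
  have "W I K = sum ?f {p. G.awalk I p K \<and> p = []} + sum ?f (\<Union>J\<in>?S. ?P J)"
    unfolding N_eq split using finS finite_awalks
    by (intro sum.union_disjoint) (auto simp flip: split)
  also have "sum ?f {p. G.awalk I p K \<and> p = []} = (if I = K then 1 else 0)"
    unfolding awalk_Nil using assms by (simp add: path_prod_def)
  also have "sum ?f (\<Union>J\<in>?S. ?P J) = (\<Sum>J\<in>?S. sum ?f (?P J))"
    using finS finite_awalks by (intro sum.UNION_disjoint) auto
  also have "\<dots> = (\<Sum>J\<in>?S. - (W I J * int (L J K)))"
  proof (rule sum.cong)
    fix J
    have "sum ?f (?P J) = (\<Sum>p | G.awalk I p J. ?f (p @ [(J, K)]))"
      by (subst sum.reindex) (auto intro: inj_onI)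
    also have "\<dots> = - (W I J * int (L J K))"
      unfolding N_eq sum_distrib_right sum_negf[symmetric]
      by (intro sum.cong) (auto simp: path_prod_def)
    finally show "sum ?f (?P J) = - (W I J * int (L J K))" .
  qed simp
  also have "\<dots> = (\<Sum>J\<in>V - {K}. - (W I J * int (L J K)))"
    using S finite_V L_outside[OF _ assms(2)] by (intro sum.mono_neutral_left) auto
  finally show ?thesis by (simp add: sum_negf)
qed

section \<open>Inverting the matrix \<open>L\<close>\<close>

text \<open>Since \<open>L\<close> has diagonal entries 1, moving the sums in the two recursions to
  the left yields the two inverse equations.\<close>

lemma path_sum_inverse: "is_L_inverse A n (path_sum A n)"
  unfolding is_L_inverse_def
proof (intro conjI ballI allI impI)
  fix I K assume IK: "I \<in> V" "K \<in> V"
  have diag: "L J J = 1" if "J \<in> V" for J using that by (intro L_diag) (simp add: sentences_def)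
  have "(\<Sum>J\<in>V. int (L I J) * W J K) = int (L I I) * W I K + (\<Sum>J\<in>V - {I}. int (L I J) * W J K)"
    using finite_V IK(1) by (rule sum.remove)
  then show "(\<Sum>J\<in>V. int (L I J) * W J K) = (if I = K then 1 else 0)"
    using N_first_step[OF IK] diag[OF IK(1)] by simp
  have "(\<Sum>J\<in>V. W I J * int (L J K)) = W I K * int (L K K) + (\<Sum>J\<in>V - {K}. W I J * int (L J K))"
    using finite_V IK(2) by (rule sum.remove)
  then show "(\<Sum>J\<in>V. W I J * int (L J K)) = (if I = K then 1 else 0)"
    using N_last_step[OF IK] diag[OF IK(2)] by simp
qed (rule N_zero)

text \<open>The usual argument N = N (L N') = (N L) N' = N' on sentences of size \<open>n\<close>;
  elsewhere both functions are 0 by definition.\<close>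

lemma is_L_inverse_unique:
  assumes N: "is_L_inverse A n N" and N': "is_L_inverse A n N'"
  shows "N = N'"
proof (intro ext)
  fix I K
  show "N I K = N' I K"
  proof (cases "I \<in> V \<and> K \<in> V")
    case True
    have "N I K = (\<Sum>J\<in>V. N I J * (if J = K then 1 else 0))"
      using finite_V True by (simp only: sum_delta_mult)
    also have "\<dots> = (\<Sum>J\<in>V. N I J * (\<Sum>M\<in>V. int (L J M) * N' M K))"
      using N' True by (intro sum.cong) (auto simp: is_L_inverse_def)
    also have "\<dots> = (\<Sum>M\<in>V. (\<Sum>J\<in>V. N I J * int (L J M)) * N' M K)"
      unfolding sum_distrib_left sum_distrib_right by (subst sum.swap) (simp add: mult.assoc)
    also have "\<dots> = (\<Sum>M\<in>V. (if I = M then 1 else 0) * N' M K)"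
      using N True by (intro sum.cong) (auto simp: is_L_inverse_def)
    also have "\<dots> = N' I K"
      using finite_V True by (simp only: sum_delta_mult)
    finally show ?thesis .
  next
    case False
    then have "N I K = 0" "N' I K = 0" using N N' unfolding is_L_inverse_def by blast+
    then show ?thesis by simp
  qed
qed

lemma L_inv_eq_path_sum: "L_inv A n = path_sum A n"
  unfolding L_inv_def
proof (rule the_equality)
  show "is_L_inverse A n (path_sum A n)" by (rule path_sum_inverse)
  show "M = path_sum A n" if "is_L_inverse A n M" for M
    using that path_sum_inverse by (rule is_L_inverse_unique)
qed

text \<open>No path exists, so the sum is empty; this lets sums over reachable sentences extend to
  all sentences.\<close>

lemma path_sum_unreachable: "\<not> I \<rightarrow>\<^sup>*\<^bsub>descent_graph A n\<^esub> K \<Longrightarrow> path_sum A n I K = 0"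
  by (auto simp: G.reachable_apath intro!: sum.neutral)

lemma reachable_sentences: "{K. I \<rightarrow>\<^sup>*\<^bsub>descent_graph A n\<^esub> K} \<subseteq> sentences A n"
  using G.reachable_in_verts(2) by (auto simp: graph_simps)

end

theorem theorem4p29:
  fixes A :: "'a set" and I :: "'a list list" and n :: nat
  assumes "finite A"
    and "I \<in> sentences A n"
  shows "F_fun I = (\<lambda>m. \<Sum>K \<in> {K. I \<rightarrow>\<^sup>*\<^bsub>descent_graph A n\<^esub> K}. L_inv A n I K * dual_immaculate K m)
    \<and> (\<forall>K \<in> sentences A n.
         L_inv A n I K =
           (\<Sum>p \<in> {p. pre_digraph.apath (descent_graph A n) I p K}. (-1) ^ length p * path_prod p))"
proof (intro conjI ballI ext)
  let ?V = "sentences A n" and ?N = "L_inv A n"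
  have inv: "is_L_inverse A n ?N"
    using path_sum_inverse[OF assms(1)] by (simp only: L_inv_eq_path_sum[OF assms(1)])
  fix m
  have fin: "finite ?V" using assms(1) by (rule finite_sentences)
  have "(\<Sum>K \<in> {K. I \<rightarrow>\<^sup>*\<^bsub>descent_graph A n\<^esub> K}. ?N I K * dual_immaculate K m)
      = (\<Sum>K\<in>?V. ?N I K * dual_immaculate K m)"
    using fin reachable_sentences[OF assms(1)] path_sum_unreachable[OF assms(1)]
    by (intro sum.mono_neutral_left) (auto simp: L_inv_eq_path_sum[OF assms(1)])
  also have "\<dots> = (\<Sum>K\<in>?V. ?N I K * (\<Sum>J\<in>?V. int (L K J) * F_fun J m))"
    using dual_immaculate_expansion[OF assms(1)] by (intro sum.cong) auto
  \<comment> \<open>Exchanging the sums brings together the product of the inverse with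
    \<open>L\<close>, which is the identity matrix.\<close>
  also have "\<dots> = (\<Sum>J\<in>?V. (\<Sum>K\<in>?V. ?N I K * int (L K J)) * F_fun J m)"
    unfolding sum_distrib_left sum_distrib_right by (subst sum.swap) (simp add: mult.assoc)
  also have "\<dots> = (\<Sum>J\<in>?V. (if I = J then 1 else 0) * F_fun J m)"
    using inv assms(2) by (intro sum.cong) (auto simp: is_L_inverse_def)
  also have "\<dots> = F_fun I m"
    using fin assms(2) by (rule sum_delta_mult(1))
  finally show "F_fun I m = (\<Sum>K \<in> {K. I \<rightarrow>\<^sup>*\<^bsub>descent_graph A n\<^esub> K}. ?N I K * dual_immaculate K m)" ..
next
  fix K assume "K \<in> sentences A n"
  show "L_inv A n I K = path_sum A n I K" by (simp only: L_inv_eq_path_sum[OF assms(1)])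
qed

end
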